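(* Let $H$ be a locally compact second countable group with a left-invariant metric $d$, acting on a probability space $(X,\mu)$, and suppose the action is exponentially mixing of all orders on an $H$-invariant subalgebra $\mathcal{A}$ of $L^\infty(X,\mu)$ with respect to $d$ and a family of seminorms $(N_s)$ as described in the context. Let $(\nu_T)$ be a sequence of positive finite Borel measures on $H$ with $\|\nu_T\|\to\infty$, such that for every integer $r\ge3$ and real $c>0$, $$\lim_{T\to\infty}\int_H \nu_T\big(B_d(h,c\log\|\nu_T\|)\big)^{r-1}\,d\nu_T(h)=0.$$ Let $f\in\mathcal{A}$ with $\mu(f)=0$ and suppose the limit $\sigma_f:=\lim_{T\to\infty}\|\nu_T*f\|_{L^2}<\infty$ exists. Then $\nu_T*f\implies N(0,\sigma_f^2)$ as $T\to\infty$.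
   Context: $\|\nu\|$ is the total mass of $\nu$, $B_d(h,\rho)$ the $d$-ball of radius $\rho$ about $h$, and $\nu*f=\int_H (h\cdot f)\,d\nu(h)$, where $h\cdot f=f\circ h^{-1}$. The action is jointly measurable and measure-preserving. $\mathcal{A}\subset L^\infty(X,\mu)$ is an $H$-invariant subalgebra and $(N_s)_{s\ge1}$ seminorms on $\mathcal{A}$ such that for all $s\ge1$, $f,f_1,f_2\in\mathcal{A}$, $h\in H$ (implied constants depending only on $s$): $N_s(f)\ll N_{s+1}(f)$; $\|f\|_{L^\infty}\ll N_s(f)$; there is $\sigma_s>0$ with $N_s(h\cdot f)\ll e^{\sigma_s d(h,e)}N_s(f)$; $N_s(f_1f_2)\ll N_{s+1}(f_1)N_{s+1}(f_2)$. Exponential mixing of all orders: for every integer $r\ge2$ there exist $\delta_r>0$ and an integer $s_r>0$ such that for all $s>s_r$, $f_1,\dots,f_r\in\mathcal{A}$, $h_1,\dots,h_r\in H$: $\big|\mu(\prod_i h_i\cdot f_i)-\prod_i\mu(f_i)\big|\le C_{r,s}e^{-\delta_r\min_{i\ne j}d(h_i,h_j)}\prod_i N_s(f_i)$. Convergence $\implies$ is convergence in distribution with respect to $\mu$. *)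

theory Defs
  imports "HOL-Probability.Probability"
begin

text \<open>The group H is modelled as a type 'h of class group_add (not necessarily
commutative; the group law is written +, identity 0, inverse uminus).
The left-invariant metric d is the metric dist of 'h, which also generates the
topology of H.\<close>

definition fun_act :: "('h::group_add \<Rightarrow> 'x \<Rightarrow> 'x) \<Rightarrow> 'h \<Rightarrow> ('x \<Rightarrow> real) \<Rightarrow> 'x \<Rightarrow> real" where
  "fun_act a h f = (\<lambda>x. f (a (- h) x))"

definition meas_conv :: "('h::group_add \<Rightarrow> 'x \<Rightarrow> 'x) \<Rightarrow> 'h measure \<Rightarrow> ('x \<Rightarrow> real) \<Rightarrow> 'x \<Rightarrow> real" where
  "meas_conv a \<nu> f = (\<lambda>x. \<integral>h. fun_act a h f x \<partial>\<nu>)"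

definition total_mass :: "'a measure \<Rightarrow> real" where
  "total_mass \<nu> = measure \<nu> (space \<nu>)"

definition lcsc_group_left_inv_metric :: "'h::{group_add, metric_space, second_countable_topology} itself \<Rightarrow> bool" where
  "lcsc_group_left_inv_metric _ \<longleftrightarrow>
     locally_compact_space (euclidean :: 'h topology) \<and>
     continuous_on UNIV (\<lambda>p::'h \<times> 'h. fst p + snd p) \<and>
     continuous_on UNIV (uminus :: 'h \<Rightarrow> 'h) \<and>
     (\<forall>g x y::'h. dist (g + x) (g + y) = dist x y)"

definition mp_action :: "('h::{group_add, topological_space} \<Rightarrow> 'x \<Rightarrow> 'x) \<Rightarrow> 'x measure \<Rightarrow> bool" where
  "mp_action a M \<longleftrightarrow>
     (\<forall>x\<in>space M. a 0 x = x) \<and>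
     (\<forall>g h. \<forall>x\<in>space M. a (g + h) x = a g (a h x)) \<and>
     (\<lambda>p. a (fst p) (snd p)) \<in> (borel \<Otimes>\<^sub>M M) \<rightarrow>\<^sub>M M \<and>
     (\<forall>h. a h \<in> M \<rightarrow>\<^sub>M M \<and> distr M M (a h) = M)"

definition inv_subalgebra :: "('h::group_add \<Rightarrow> 'x \<Rightarrow> 'x) \<Rightarrow> 'x measure \<Rightarrow> ('x \<Rightarrow> real) set \<Rightarrow> bool" where
  "inv_subalgebra a M A \<longleftrightarrow>
     (\<forall>f\<in>A. f \<in> borel_measurable M \<and> (\<exists>B. AE x in M. \<bar>f x\<bar> \<le> B)) \<and>
     (\<lambda>x. 0) \<in> A \<and>
     (\<forall>f\<in>A. \<forall>g\<in>A. (\<lambda>x. f x + g x) \<in> A) \<and>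
     (\<forall>f\<in>A. \<forall>c::real. (\<lambda>x. c * f x) \<in> A) \<and>
     (\<forall>f\<in>A. \<forall>g\<in>A. (\<lambda>x. f x * g x) \<in> A) \<and>
     (\<forall>f\<in>A. \<forall>h. fun_act a h f \<in> A)"

definition seminorm_family :: "('h::{group_add, metric_space} \<Rightarrow> 'x \<Rightarrow> 'x) \<Rightarrow> 'x measure \<Rightarrow> ('x \<Rightarrow> real) set
     \<Rightarrow> (nat \<Rightarrow> ('x \<Rightarrow> real) \<Rightarrow> real) \<Rightarrow> bool" where
  "seminorm_family a M A N \<longleftrightarrow>
     (\<forall>s\<ge>1. \<forall>f\<in>A. \<forall>g\<in>A. \<forall>c::real.
        N s f \<ge> 0 \<and> N s (\<lambda>x. f x + g x) \<le> N s f + N s g \<and> N s (\<lambda>x. c * f x) = \<bar>c\<bar> * N s f) \<and>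
     (\<forall>s\<ge>1. \<exists>C. \<forall>f\<in>A. N s f \<le> C * N (s + 1) f) \<and>
     (\<forall>s\<ge>1. \<exists>C. \<forall>f\<in>A. AE x in M. \<bar>f x\<bar> \<le> C * N s f) \<and>
     (\<forall>s\<ge>1. \<exists>\<sigma>>0. \<exists>C. \<forall>f\<in>A. \<forall>h. N s (fun_act a h f) \<le> C * exp (\<sigma> * dist h 0) * N s f) \<and>
     (\<forall>s\<ge>1. \<exists>C. \<forall>f1\<in>A. \<forall>f2\<in>A. N s (\<lambda>x. f1 x * f2 x) \<le> C * N (s + 1) f1 * N (s + 1) f2)"

definition exp_mixing_all_orders :: "('h::{group_add, metric_space} \<Rightarrow> 'x \<Rightarrow> 'x) \<Rightarrow> 'x measure \<Rightarrow> ('x \<Rightarrow> real) set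
     \<Rightarrow> (nat \<Rightarrow> ('x \<Rightarrow> real) \<Rightarrow> real) \<Rightarrow> bool" where
  "exp_mixing_all_orders a M A N \<longleftrightarrow>
     (\<forall>r::nat\<ge>2. \<exists>\<delta>>0. \<exists>sr::nat>0. \<forall>s>sr. \<exists>C. \<forall>fs::nat \<Rightarrow> 'x \<Rightarrow> real. \<forall>hs::nat \<Rightarrow> 'h.
        (\<forall>i<r. fs i \<in> A) \<longrightarrow>
        \<bar>(\<integral>x. (\<Prod>i<r. fun_act a (hs i) (fs i) x) \<partial>M) - (\<Prod>i<r. \<integral>x. fs i x \<partial>M)\<bar>
          \<le> C * exp (- \<delta> * Min {dist (hs i) (hs j) | i j. i < r \<and> j < r \<and> i \<noteq> j}) * (\<Prod>i<r. N s (fs i)))"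

definition centered_gaussian :: "real \<Rightarrow> real measure" where
  "centered_gaussian \<sigma> =
     (if \<sigma> = 0 then return borel 0 else density lborel (normal_density 0 \<bar>\<sigma>\<bar>))"

end

theory Submission
  imports Defs
begin

text \<open>
  The moments of \<open>\<nu>\<^sub>T * f\<close> are integrals over \<open>H\<^sup>r\<close> of the correlations \<open>\<mu>(\<Prod>\<^sub>i h\<^sub>i \<cdot> f)\<close>, and the same holds
  for its cumulants, with the joint cumulant of the \<open>h\<^sub>i \<cdot> f\<close> as integrand. Joint cumulants vanish as soon as
  the correlations factorize across a splitting of the indices into two nonempty parts. Merging nearby points at
  successively larger scales, all multiples of \<open>log \<parallel>\<nu>\<^sub>T\<parallel>\<close>, shows that either all \<open>h\<^sub>i\<close> lie within
  \<open>c log \<parallel>\<nu>\<^sub>T\<parallel>\<close> of each other, or they form at least two clusters whose distances dominate their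
  diameters. In the second case exponential mixing makes the cumulant \<open>O(\<parallel>\<nu>\<^sub>T\<parallel>\<^bsup>-(r+1)\<^esup>)\<close>; the first case has
  vanishing mass for \<open>r \<ge> 3\<close> by the hypothesis on \<open>\<nu>\<^sub>T\<close>. Hence all cumulants of order at least 3 tend to 0,
  all moments converge to those of the Gaussian, and so do the characteristic functions.
\<close>

section \<open>Cumulants\<close>

text \<open>
  Joint cumulants of a family of moments \<open>m\<close>, defined by the recursion that removes the block containing the
  least index: this avoids set partitions altogether.
\<close>

function cumulant :: "(nat set \<Rightarrow> real) \<Rightarrow> nat set \<Rightarrow> real" where
  "cumulant m S =
     (if finite S then m S - (\<Sum>J\<in>{J. J \<subset> S \<and> Min S \<in> J}. cumulant m J * m (S - J)) else 0)"
  by pat_completeness auto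
termination
  by (relation "Wellfounded.measure (\<lambda>(m, S). card S)") (auto intro: psubset_card_mono)

declare cumulant.simps [simp del]

text \<open>The defining recursion solved for \<open>m S\<close>: it lacks only the block
  \<open>J = S\<close>, whose companion factor is \<open>m {} = 1\<close>.\<close>

lemma moment_eq_sum_cumulant:
  assumes "finite S" "S \<noteq> {}" "m {} = 1"
  shows "m S = (\<Sum>J\<in>{J. J \<subseteq> S \<and> Min S \<in> J}. cumulant m J * m (S - J))"
proof -
  have fin: "finite {J. J \<subset> S \<and> Min S \<in> J}"
    by (rule finite_subset[of _ "Pow S"]) (use assms in auto)
  have "{J. J \<subseteq> S \<and> Min S \<in> J} = insert S {J. J \<subset> S \<and> Min S \<in> J}"
    using assms Min_in by auto
  then show ?thesis
    using fin assms by (simp add: cumulant.simps[of m S])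
qed

lemma cumulant_cong:
  assumes "\<And>J. J \<subseteq> S \<Longrightarrow> m J = m' J"
  shows "cumulant m S = cumulant m' S"
proof (cases "finite S")
  case True
  then show ?thesis using assms
  proof (induction S rule: finite_psubset_induct)
    case (psubset S)
    have "(\<Sum>J\<in>{J. J \<subset> S \<and> Min S \<in> J}. cumulant m J * m (S - J))
        = (\<Sum>J\<in>{J. J \<subset> S \<and> Min S \<in> J}. cumulant m' J * m' (S - J))"
      using psubset by (intro sum.cong refl) auto
    then show ?case
      using psubset by (simp add: cumulant.simps[of _ S])
  qed
qed (simp add: cumulant.simps)

lemma cumulant_singleton: "cumulant m {i} = m {i}"
proof -
  have "{J. J \<subset> {i} \<and> Min {i} \<in> J} = {}" by auto
  then have "(\<Sum>J\<in>{J. J \<subset> {i} \<and> Min {i} \<in> J}. cumulant m J * m ({i} - J)) = 0" by (simp only: sum.empty)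
  then show ?thesis by (simp add: cumulant.simps[of m "{i}"])
qed

lemma cumulant_doubleton:
  assumes "i \<noteq> j" shows "cumulant m {i, j} = m {i, j} - m {i} * m {j}"
proof -
  have *: "cumulant m {i, j} = m {i, j} - m {i} * m {j}" if "i < j" for i j
  proof -
    have "{J. J \<subset> {i, j} \<and> Min {i, j} \<in> J} = {{i}}" using that by auto
    moreover have "{i, j} - {i} = {j}" using that by auto
    ultimately show ?thesis by (subst cumulant.simps) (simp add: cumulant_singleton)
  qed
  show ?thesis
    using *[of i j] *[of j i] assms by (cases "i < j") (auto simp: insert_commute mult.commute)
qed

lemma card_subsets_le:
  assumes "finite S" "card S \<le> n"
  shows "real (card {J. J \<subseteq> S \<and> P J}) \<le> 2 ^ n"
proof -
  have "card {J. J \<subseteq> S \<and> P J} \<le> card (Pow S)"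
    by (rule card_mono) (use assms in auto)
  also have "\<dots> \<le> 2 ^ n" using assms by (simp add: card_Pow)
  finally show ?thesis by (metis of_nat_le_iff of_nat_numeral of_nat_power)
qed

text \<open>Induction on the cardinality along the recursion. What matters is the order of
  quantifiers: \<open>G\<close> depends only on \<open>n\<close> and \<open>b\<close>, so it serves
  all configurations of group elements at once.\<close>

lemma cumulant_bounded:
  fixes b :: real
  assumes "b \<ge> 0"
  shows "\<exists>G\<ge>0. \<forall>S m. finite S \<longrightarrow> card S \<le> n \<longrightarrow> (\<forall>J\<subseteq>S. \<bar>m J\<bar> \<le> b) \<longrightarrow> \<bar>cumulant m S\<bar> \<le> G"
proof (induction n)
  case 0
  have "\<bar>cumulant m S\<bar> \<le> b" if "finite S" "card S \<le> 0" "\<forall>J\<subseteq>S. \<bar>m J\<bar> \<le> b" for S m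
  proof -
    have "S = {}" using that by auto
    moreover have "{J. J \<subset> S \<and> Min S \<in> J} = {}" using calculation by auto
    ultimately have "cumulant m S = m {}" by (subst cumulant.simps) simp
    then show ?thesis using that by auto
  qed
  then show ?case using assms by blast
next
  case (Suc n)
  then obtain G where G: "G \<ge> 0"
    "\<And>S m. finite S \<Longrightarrow> card S \<le> n \<Longrightarrow> \<forall>J\<subseteq>S. \<bar>m J\<bar> \<le> b \<Longrightarrow> \<bar>cumulant m S\<bar> \<le> G"
    by blast
  have "\<bar>cumulant m S\<bar> \<le> b + 2 ^ Suc n * (G * b)"
    if S: "finite S" "card S \<le> Suc n" "\<forall>J\<subseteq>S. \<bar>m J\<bar> \<le> b" for S m
  proof -
    have "\<bar>\<Sum>J\<in>{J. J \<subset> S \<and> Min S \<in> J}. cumulant m J * m (S - J)\<bar>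
        \<le> (\<Sum>J\<in>{J. J \<subset> S \<and> Min S \<in> J}. G * b)"
    proof (rule order_trans[OF sum_abs sum_mono])
      fix J assume J: "J \<in> {J. J \<subset> S \<and> Min S \<in> J}"
      then have "card J < card S" using S by (auto intro: psubset_card_mono)
      then have "\<bar>cumulant m J\<bar> \<le> G"
        using J S by (intro G(2)) (auto intro: finite_subset)
      moreover have "\<bar>m (S - J)\<bar> \<le> b" using S by auto
      ultimately show "\<bar>cumulant m J * m (S - J)\<bar> \<le> G * b"
        by (simp add: abs_mult mult_mono)
    qed
    also have "\<dots> = real (card {J. J \<subseteq> S \<and> (J \<noteq> S \<and> Min S \<in> J)}) * (G * b)"
      by (simp add: psubset_eq conj_ac)
    also have "\<dots> \<le> 2 ^ Suc n * (G * b)"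
      using card_subsets_le[OF S(1,2)] G(1) assms by (intro mult_right_mono) auto
    finally show ?thesis
      using S(1) S(3)[rule_format, of S] by (simp add: cumulant.simps[of m S])
  qed
  then show ?case
    using G(1) assms by (intro exI[of _ "b + 2 ^ Suc n * (G * b)"]) auto
qed

text \<open>Quantitative form of the vanishing of cumulants of independent groups. With
  \<open>Min S\<close> in \<open>A\<close>, the blocks inside \<open>A\<close> reproduce the
  recursion for \<open>S \<inter> A\<close>, and their sum cancels \<open>m S\<close> up to
  multiples of \<open>\<epsilon>\<close>. Every other proper block is itself split by
  \<open>A\<close>, so its cumulant is small by induction.\<close>

lemma cumulant_almost_factorizing:
  fixes b :: real
  assumes b: "b \<ge> 0"
  shows "\<exists>G\<ge>0. \<forall>S m A \<epsilon>. finite S \<longrightarrow> card S \<le> n \<longrightarrow> m {} = 1 \<longrightarrow> (\<forall>J\<subseteq>S. \<bar>m J\<bar> \<le> b) \<longrightarrow>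
     S \<inter> A \<noteq> {} \<longrightarrow> S - A \<noteq> {} \<longrightarrow> (\<forall>J\<subseteq>S. \<bar>m J - m (J \<inter> A) * m (J - A)\<bar> \<le> \<epsilon>) \<longrightarrow>
     \<bar>cumulant m S\<bar> \<le> G * \<epsilon>"
proof (induction n)
  case 0
  \<comment> \<open>Vacuous: the empty set cannot meet both \<open>A\<close> and its
    complement.\<close>
  then show ?case by (intro exI[of _ 0]) auto
next
  case (Suc n)
  then obtain G where G: "G \<ge> 0"
    "\<And>S m A \<epsilon>. finite S \<Longrightarrow> card S \<le> n \<Longrightarrow> m {} = 1 \<Longrightarrow> \<forall>J\<subseteq>S. \<bar>m J\<bar> \<le> b \<Longrightarrow>
       S \<inter> A \<noteq> {} \<Longrightarrow> S - A \<noteq> {} \<Longrightarrow> \<forall>J\<subseteq>S. \<bar>m J - m (J \<inter> A) * m (J - A)\<bar> \<le> \<epsilon> \<Longrightarrow>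
       \<bar>cumulant m S\<bar> \<le> G * \<epsilon>"
    by blast
  obtain K where K: "K \<ge> 0"
    "\<And>S m. finite S \<Longrightarrow> card S \<le> Suc n \<Longrightarrow> \<forall>J\<subseteq>S. \<bar>m J\<bar> \<le> b \<Longrightarrow> \<bar>cumulant m S\<bar> \<le> K"
    using cumulant_bounded[OF b, of "Suc n"] by blast
  \<comment> \<open>The three summands pay for the defect of factorization at \<open>S\<close>
    itself, for the blocks in \<open>V\<close> and for the blocks in \<open>U\<close>, in this
    order.\<close>
  define G' where "G' = 1 + 2 ^ Suc n * (G * b) + 2 ^ Suc n * K"
  have main: "\<bar>cumulant m S\<bar> \<le> G' * \<epsilon>"
    if S: "finite S" "card S \<le> Suc n" "m {} = 1" "\<forall>J\<subseteq>S. \<bar>m J\<bar> \<le> b" "S - A \<noteq> {}"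
      "\<forall>J\<subseteq>S. \<bar>m J - m (J \<inter> A) * m (J - A)\<bar> \<le> \<epsilon>" and MinA: "Min S \<in> A" for S m A \<epsilon>
  proof -
    have MinS: "Min S \<in> S" using S by (intro Min_in) auto
    \<comment> \<open>The case \<open>J = {}\<close> of the factorization hypothesis reads
      \<open>0 \<le> \<epsilon>\<close>.\<close>
    have eps: "\<epsilon> \<ge> 0" using S(6)[rule_format, of "{}"] S(3) by simp
    \<comment> \<open>As \<open>S\<close> and \<open>S \<inter> A\<close> have the same least
      element, the recursion for \<open>S \<inter> A\<close> runs exactly over
      \<open>U\<close>.\<close>
    have MinSA: "Min (S \<inter> A) = Min S"
      using S(1) MinA MinS by (intro Min_eqI) auto
    define U where "U = {J. J \<subseteq> S \<inter> A \<and> Min S \<in> J}"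
    define V where "V = {J. J \<subseteq> S \<and> (J \<noteq> S \<and> Min S \<in> J \<and> \<not> J \<subseteq> A)}"
    have finUV: "finite U" "finite V"
      unfolding U_def V_def by (rule finite_subset[of _ "Pow S"]; use S(1) in auto)+
    have "{J. J \<subset> S \<and> Min S \<in> J} = U \<union> V" "U \<inter> V = {}"
      using S(5) unfolding U_def V_def by auto
    then have "cumulant m S = m S - (\<Sum>J\<in>U. cumulant m J * m (S - J)) - (\<Sum>J\<in>V. cumulant m J * m (S - J))"
      using S(1) finUV by (simp add: cumulant.simps[of m S] sum.union_disjoint)
    moreover have "m (S \<inter> A) * m (S - A) = (\<Sum>J\<in>U. cumulant m J * (m (S \<inter> A - J) * m (S - A)))"
    proof -
      have "S \<inter> A \<noteq> {}" using MinS MinA by blast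
      then have "m (S \<inter> A) = (\<Sum>J\<in>U. cumulant m J * m (S \<inter> A - J))"
        using moment_eq_sum_cumulant[of "S \<inter> A" m] S(1,3) by (simp only: MinSA U_def) simp
      then show ?thesis by (simp add: sum_distrib_right mult.assoc)
    qed
    \<comment> \<open>The product \<open>m (S \<inter> A) * m (S - A)\<close> has been added and
      subtracted, so each block in \<open>U\<close> is now multiplied by a factorization
      defect.\<close>
    ultimately have eq: "cumulant m S = (m S - m (S \<inter> A) * m (S - A))
        - (\<Sum>J\<in>U. cumulant m J * (m (S - J) - m (S \<inter> A - J) * m (S - A)))
        - (\<Sum>J\<in>V. cumulant m J * m (S - J))"
      by (simp add: right_diff_distrib sum_subtractf)
    have "\<bar>\<Sum>J\<in>U. cumulant m J * (m (S - J) - m (S \<inter> A - J) * m (S - A))\<bar> \<le> (\<Sum>J\<in>U. K * \<epsilon>)"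
    proof (rule order_trans[OF sum_abs sum_mono])
      fix J assume J: "J \<in> U"
      then have "card J \<le> card S" using S(1) by (auto simp: U_def intro: card_mono)
      then have "\<bar>cumulant m J\<bar> \<le> K"
        using J S by (intro K(2)) (auto simp: U_def intro: finite_subset)
      moreover have "(S - J) \<inter> A = S \<inter> A - J" "S - J - A = S - A"
        using J by (auto simp: U_def)
      then have "\<bar>m (S - J) - m (S \<inter> A - J) * m (S - A)\<bar> \<le> \<epsilon>"
        using S(6)[rule_format, of "S - J"] by auto
      ultimately show "\<bar>cumulant m J * (m (S - J) - m (S \<inter> A - J) * m (S - A))\<bar> \<le> K * \<epsilon>"
        by (simp add: abs_mult mult_mono)
    qed
    also have "\<dots> \<le> 2 ^ Suc n * (K * \<epsilon>)"
    proof -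
      have "U = {J. J \<subseteq> S \<and> (J \<subseteq> A \<and> Min S \<in> J)}" by (auto simp: U_def)
      then show ?thesis
        using card_subsets_le[OF S(1,2), of "\<lambda>J. J \<subseteq> A \<and> Min S \<in> J"] K(1) eps
        by (simp add: mult_right_mono)
    qed
    finally have sU: "\<bar>\<Sum>J\<in>U. cumulant m J * (m (S - J) - m (S \<inter> A - J) * m (S - A))\<bar>
        \<le> 2 ^ Suc n * (K * \<epsilon>)" .
    \<comment> \<open>A block in \<open>V\<close> contains \<open>Min S\<close>, which lies in
      \<open>A\<close>, and also a point outside \<open>A\<close>: the induction hypothesis applies
      to it.\<close>
    have "\<bar>\<Sum>J\<in>V. cumulant m J * m (S - J)\<bar> \<le> (\<Sum>J\<in>V. (G * \<epsilon>) * b)"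
    proof (rule order_trans[OF sum_abs sum_mono])
      fix J assume J: "J \<in> V"
      then have "card J < card S" using S(1) by (auto simp: V_def intro: psubset_card_mono)
      then have "\<bar>cumulant m J\<bar> \<le> G * \<epsilon>"
        using J S MinA by (intro G(2)[where A = A]) (auto simp: V_def intro: finite_subset)
      moreover have "\<bar>m (S - J)\<bar> \<le> b" using S(4) by auto
      ultimately show "\<bar>cumulant m J * m (S - J)\<bar> \<le> (G * \<epsilon>) * b"
        unfolding abs_mult using G(1) eps by (intro mult_mono) auto
    qed
    also have "\<dots> \<le> 2 ^ Suc n * ((G * \<epsilon>) * b)"
      using card_subsets_le[OF S(1,2), of "\<lambda>J. J \<noteq> S \<and> Min S \<in> J \<and> \<not> J \<subseteq> A"] G(1) eps b
      by (simp add: mult_right_mono V_def)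
    finally have sV: "\<bar>\<Sum>J\<in>V. cumulant m J * m (S - J)\<bar> \<le> 2 ^ Suc n * ((G * \<epsilon>) * b)" .
    have "\<bar>m S - m (S \<inter> A) * m (S - A)\<bar> \<le> \<epsilon>" using S(6) by auto
    with sU sV have "\<bar>cumulant m S\<bar> \<le> \<epsilon> + 2 ^ Suc n * (K * \<epsilon>) + 2 ^ Suc n * ((G * \<epsilon>) * b)"
      unfolding eq by linarith
    also have "\<dots> = G' * \<epsilon>" unfolding G'_def by (simp add: algebra_simps)
    finally show ?thesis .
  qed
  have "\<bar>cumulant m S\<bar> \<le> G' * \<epsilon>"
    if S: "finite S" "card S \<le> Suc n" "m {} = 1" "\<forall>J\<subseteq>S. \<bar>m J\<bar> \<le> b" "S \<inter> A \<noteq> {}" "S - A \<noteq> {}"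
      "\<forall>J\<subseteq>S. \<bar>m J - m (J \<inter> A) * m (J - A)\<bar> \<le> \<epsilon>" for S m A \<epsilon>
  proof (cases "Min S \<in> A")
    case True
    then show ?thesis using main S by blast
  next
    case False
    \<comment> \<open>The hypotheses are symmetric in \<open>A\<close> and its complement, so
      \<open>A\<close> may be taken to contain \<open>Min S\<close>.\<close>
    have "J \<inter> - A = J - A" "J - - A = J \<inter> A" for J by auto
    then show ?thesis
      using main[of S m "- A" \<epsilon>] S False by (simp add: mult.commute)
  qed
  moreover have "G' \<ge> 0" using G(1) K(1) b by (simp add: G'_def)
  ultimately show ?case by blast
qed

section \<open>Gaussian moments from vanishing higher cumulants\<close>

text \<open>In the limit only the blocks of size 2 containing \<open>Min S\<close> survive in the
  moment recursion. There are \<open>card S - 1\<close> of them, each contributing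
  \<open>v * g (card S - 2)\<close>, which is the recursion for Gaussian moments.\<close>

lemma cumulants_imp_gaussian_moments:
  fixes m :: "nat \<Rightarrow> nat set \<Rightarrow> real" and g :: "nat \<Rightarrow> real"
  assumes m0: "\<And>T. m T {} = 1"
    and c1: "\<And>S. card S = 1 \<Longrightarrow> (\<lambda>T. cumulant (m T) S) \<longlonglongrightarrow> 0"
    and c2: "\<And>S. card S = 2 \<Longrightarrow> (\<lambda>T. cumulant (m T) S) \<longlonglongrightarrow> v"
    and c3: "\<And>S. finite S \<Longrightarrow> card S \<ge> 3 \<Longrightarrow> (\<lambda>T. cumulant (m T) S) \<longlonglongrightarrow> 0"
    and g: "g 0 = 1" "g 1 = 0" "\<And>k. g (k + 2) = (real k + 1) * v * g k"
    and S: "finite S"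
  shows "(\<lambda>T. m T S) \<longlonglongrightarrow> g (card S)"
  using S
proof (induction S rule: finite_psubset_induct)
  case (psubset S)
  show ?case
  proof (cases "S = {}")
    case False
    define P where "P = {J. J \<subseteq> S \<and> Min S \<in> J}"
    define Q where "Q = (\<lambda>j. {Min S, j}) ` (S - {Min S})"
    have MinS: "Min S \<in> S" using psubset.hyps False by auto
    have finP: "finite P" unfolding P_def by (rule finite_subset[of _ "Pow S"]) (use psubset in auto)
    have QP: "Q \<subseteq> P" using MinS by (auto simp: Q_def P_def)
    have Q: "J \<in> Q" if JP: "J \<in> P" and J2: "card J = 2" for J
    proof -
      obtain x y where "J = {x, y}" "x \<noteq> y" using J2 by (auto simp: card_2_iff)
      then show ?thesis using JP by (auto simp: P_def Q_def insert_commute)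
    qed
    have card2: "card J = 2" if "J \<in> Q" for J using that unfolding Q_def card_2_iff by blast
    \<comment> \<open>The limit of the term of block \<open>J\<close>; \<open>Q\<close> consists of
      the pairs in \<open>P\<close>.\<close>
    define l where "l J = (if J \<in> Q then v * g (card S - 2) else 0)" for J
    have "(\<lambda>T. \<Sum>J\<in>P. cumulant (m T) J * m T (S - J)) \<longlonglongrightarrow> (\<Sum>J\<in>P. l J)"
    proof (rule tendsto_sum)
      fix J assume J: "J \<in> P"
      then have finJ: "finite J" and JS: "J \<subseteq> S" "S - J \<subset> S" and J0: "J \<noteq> {}"
        using psubset.hyps MinS by (auto simp: P_def intro: finite_subset)
      have IH: "(\<lambda>T. m T (S - J)) \<longlonglongrightarrow> g (card (S - J))" by (rule psubset.IH[OF JS(2)])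
      have "card J \<noteq> 0" using finJ J0 by simp
      then consider "card J = 1" | "card J = 2" | "card J \<ge> 3" by linarith
      then show "(\<lambda>T. cumulant (m T) J * m T (S - J)) \<longlonglongrightarrow> l J"
      proof cases
        case 2
        then have "l J = v * g (card (S - J))" using Q[OF J] JS finJ by (simp add: l_def card_Diff_subset)
        then show ?thesis using tendsto_mult[OF c2[OF 2] IH] by simp
      next
        case 1
        then have "l J = 0 * g (card (S - J))" using card2[of J] by (auto simp: l_def)
        then show ?thesis using tendsto_mult[OF c1[OF 1] IH] by simp
      next
        case 3
        then have "l J = 0 * g (card (S - J))" using card2[of J] by (auto simp: l_def)
        then show ?thesis using tendsto_mult[OF c3[OF finJ 3] IH] by simp
      qed
    qed
    moreover have "(\<Sum>J\<in>P. cumulant (m T) J * m T (S - J)) = m T S" for T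
      using moment_eq_sum_cumulant[of S "m T"] psubset.hyps False m0 by (simp add: P_def)
    moreover have "(\<Sum>J\<in>P. l J) = g (card S)"
    proof -
      have inj: "inj_on (\<lambda>j. {Min S, j}) (S - {Min S})" by (auto simp: inj_on_def doubleton_eq_iff)
      have "(\<Sum>J\<in>P. l J) = (\<Sum>J\<in>Q. v * g (card S - 2))"
        using QP finP by (simp add: l_def sum.If_cases Int_absorb1)
      also have "\<dots> = real (card S - 1) * (v * g (card S - 2))"
        using inj MinS psubset.hyps by (simp add: Q_def card_image)
      also have "\<dots> = g (card S)"
      \<comment> \<open>For a singleton the number of pairs is 0, so the truncated
        \<open>card S - 2\<close> does no harm, and \<open>g 1 = 0\<close>.\<close>
      proof (cases "card S = 1")
        case False
        have "card S \<noteq> 0" using psubset.hyps \<open>S \<noteq> {}\<close> by simp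
        then have "card S = (card S - 2) + 2" using False by linarith
        then obtain k where "card S = k + 2" by blast
        then show ?thesis using g(3)[of k] by simp
      qed (use g in simp)
      finally show ?thesis .
    qed
    ultimately show ?thesis by simp
  qed (use m0 g in simp)
qed

section \<open>The method of moments\<close>

text \<open>Scaling a standard normal variable, rather than using a density of deviation
  \<open>\<sigma>\<close>, includes the degenerate case \<open>\<sigma> = 0\<close>.\<close>

abbreviation scaled_normal_moment :: "real \<Rightarrow> nat \<Rightarrow> real" where
  "scaled_normal_moment \<sigma> k \<equiv> \<integral>x. (\<sigma> * x) ^ k \<partial>std_normal_distribution"

lemma scaled_normal_moment_even:
  "scaled_normal_moment \<sigma> (2 * k) = \<sigma> ^ (2 * k) * (fact (2 * k) / (2 ^ k * fact k))"
  by (simp only: power_mult_distrib integral_mult_right_zero std_normal_distribution_even_moments)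

lemma scaled_normal_moment_odd: "odd k \<Longrightarrow> scaled_normal_moment \<sigma> k = 0"
  by (simp add: power_mult_distrib integral_std_normal_distribution_moment_odd)

text \<open>This is the recursion satisfied by the limiting moments when all cumulants of order at
  least 3 vanish.\<close>

lemma scaled_normal_moment_Suc_Suc:
  "scaled_normal_moment \<sigma> (k + 2) = (real k + 1) * \<sigma>\<^sup>2 * scaled_normal_moment \<sigma> k"
proof (cases "even k")
  case True
  then obtain j where j: "k = 2 * j" by (auto elim: evenE)
  have "scaled_normal_moment \<sigma> (k + 2) = scaled_normal_moment \<sigma> (2 * Suc j)" by (simp add: j)
  also have "\<dots> = (real k + 1) * \<sigma>\<^sup>2 * (\<sigma> ^ (2 * j) * (fact (2 * j) / (2 ^ j * fact j)))"
  proof -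
    have "fact (2 * Suc j) = (2 * real j + 2) * (2 * real j + 1) * fact (2 * j)"
      by (simp add: algebra_simps)
    moreover have "fact (Suc j) = (real j + 1) * fact j" by simp
    ultimately show ?thesis
      unfolding scaled_normal_moment_even j
      by (simp add: power2_eq_square divide_simps del: fact_Suc)
  qed
  also have "\<dots> = (real k + 1) * \<sigma>\<^sup>2 * scaled_normal_moment \<sigma> k"
    by (simp only: j scaled_normal_moment_even)
  finally show ?thesis .
qed (simp only: scaled_normal_moment_odd even_add even_numeral simp_thms mult_zero_right)

text \<open>Unifies the point mass at \<open>\<sigma> = 0\<close> with the density case, and
  negative \<open>\<sigma>\<close> with \<open>\<bar>\<sigma>\<bar>\<close>, so that moments and
  Taylor estimates can be taken over the standard normal law.\<close>

lemma centered_gaussian_eq_distr: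
  "centered_gaussian \<sigma> = distr std_normal_distribution borel (\<lambda>x. \<sigma> * x)"
proof -
  interpret prob_space std_normal_distribution
    using real_dist_normal_dist by (simp add: real_distribution_def)
  show ?thesis
  proof (cases "\<sigma> = 0")
    case True
    then show ?thesis
      by (simp add: centered_gaussian_def)
  next
    case False
    have "distributed std_normal_distribution lborel (\<lambda>x. x) std_normal_density"
      by (auto simp: distributed_def distr_id2)
    from normal_density_affine[OF this, of \<sigma> 0] False
    have "distributed std_normal_distribution lborel (\<lambda>x. \<sigma> * x) (normal_density 0 \<bar>\<sigma>\<bar>)"
      by simp
    then have "distr std_normal_distribution lborel (\<lambda>x. \<sigma> * x) = density lborel (normal_density 0 \<bar>\<sigma>\<bar>)"
      by (simp add: distributed_def)
    moreover have "distr std_normal_distribution lborel (\<lambda>x. \<sigma> * x) = distr std_normal_distribution borel (\<lambda>x. \<sigma> * x)"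
      by (rule distr_cong) auto
    ultimately show ?thesis using False by (simp add: centered_gaussian_def)
  qed
qed

text \<open>Taylor expansion of characteristic functions to degree \<open>2 * k\<close>: the
  remainder is controlled by the moment of order \<open>2 * k\<close>, and for the Gaussian this
  bound tends to 0 with \<open>k\<close>. Fixing \<open>k\<close> first and then letting
  \<open>n\<close> grow gives pointwise convergence, and Levy continuity concludes.\<close>

lemma gaussian_moments_imp_weak_conv:
  fixes X :: "nat \<Rightarrow> 'x \<Rightarrow> real"
  assumes P: "prob_space M"
    and X [measurable]: "\<And>n. X n \<in> borel_measurable M"
    and int: "\<And>n k. integrable M (\<lambda>x. X n x ^ k)"
    and mom: "\<And>k. (\<lambda>n. \<integral>x. X n x ^ k \<partial>M) \<longlonglongrightarrow> scaled_normal_moment \<sigma> k"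
  shows "weak_conv_m (\<lambda>n. distr M borel (X n)) (centered_gaussian \<sigma>)"
proof (rule levy_continuity)
  interpret prob_space M by fact
  interpret std: prob_space std_normal_distribution
    using real_dist_normal_dist by (simp add: real_distribution_def)
  show "real_distribution (distr M borel (X n))" for n
    by (rule real_distribution_distr) simp
  show "real_distribution (centered_gaussian \<sigma>)"
    unfolding centered_gaussian_eq_distr by (rule std.real_distribution_distr) simp
  fix t :: real
  \<comment> \<open>The remainder bound for the Gaussian: the factor \<open>fact (2 * k)\<close> of
    the even moment cancels, which leaves twice a term of a convergent exponential series.\<close>
  define e where "e k = 2 * ((t\<^sup>2 * \<sigma>\<^sup>2 / 2) ^ k / fact k)" for k
  have "e \<longlonglongrightarrow> 2 * 0"
    unfolding e_def
    by (intro tendsto_intros summable_LIMSEQ_zero)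
       (use summable_exp[of "t\<^sup>2 * \<sigma>\<^sup>2 / 2"] in \<open>simp add: field_simps\<close>)
  \<comment> \<open>Taylor polynomials of even degree, so that the absolute moment in the remainder
    is an ordinary moment.\<close>
  define p where "p n k = (\<Sum>j\<le>2 * k. ((\<i> * t) ^ j / fact j) * (\<integral>x. X n x ^ j \<partial>M))" for n k
  define q where "q k = (\<Sum>j\<le>2 * k. ((\<i> * t) ^ j / fact j) * scaled_normal_moment \<sigma> j)" for k
  define c where "c k = 2 * \<bar>t\<bar> ^ (2 * k) / fact (2 * k)" for k
  have ce: "c k * scaled_normal_moment \<sigma> (2 * k) = e k" for k
    unfolding scaled_normal_moment_even c_def e_def
    by (simp add: power_mult power_mult_distrib power_divide)
  have pq: "(\<lambda>n. p n k) \<longlonglongrightarrow> q k" for k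
    unfolding p_def q_def by (intro tendsto_intros mom)
  have cm: "(\<lambda>n. c k * (\<integral>x. X n x ^ (2 * k) \<partial>M)) \<longlonglongrightarrow> e k" for k
    unfolding ce[symmetric] by (intro tendsto_intros mom)
  have X_approx: "cmod (char (distr M borel (X n)) t - p n k) \<le> c k * (\<integral>x. X n x ^ (2 * k) \<partial>M)" for n k
    using char_approx1'[OF int X refl, of n t "2 * k"]
    by (simp add: p_def c_def power_even_abs)
  have "integrable std_normal_distribution (\<lambda>x. (\<sigma> * x) ^ k)" for k
    unfolding power_mult_distrib
    by (intro integrable_mult_right integrable_std_normal_distribution_moment)
  then have G_approx: "cmod (char (centered_gaussian \<sigma>) t - q k) \<le> e k" for k
    using std.char_approx1'[of "2 * k" "\<lambda>x. \<sigma> * x" "centered_gaussian \<sigma>" t] ce[of k]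
    by (simp add: q_def c_def power_even_abs centered_gaussian_eq_distr)
  show "(\<lambda>n. char (distr M borel (X n)) t) \<longlonglongrightarrow> char (centered_gaussian \<sigma>) t"
  proof (rule tendstoI)
    fix \<epsilon> :: real assume "\<epsilon> > 0"
    \<comment> \<open>The degree \<open>k\<close> is chosen from the Gaussian alone; only afterwards
      is \<open>n\<close> taken large.\<close>
    then have "eventually (\<lambda>k. e k < \<epsilon> / 4) sequentially"
      using order_tendstoD(2)[OF \<open>e \<longlonglongrightarrow> 2 * 0\<close>, of "\<epsilon> / 4"] by simp
    then obtain k where k: "e k < \<epsilon> / 4" by (auto simp: eventually_sequentially)
    have "eventually (\<lambda>n. dist (p n k) (q k) < \<epsilon> / 4) sequentially"
      using pq[of k] \<open>\<epsilon> > 0\<close> by (intro tendstoD) auto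
    moreover have "eventually (\<lambda>n. c k * (\<integral>x. X n x ^ (2 * k) \<partial>M) < \<epsilon> / 4) sequentially"
      using order_tendstoD(2)[OF cm[of k] k] .
    ultimately show "eventually (\<lambda>n. dist (char (distr M borel (X n)) t) (char (centered_gaussian \<sigma>) t) < \<epsilon>) sequentially"
    proof eventually_elim
      case (elim n)
      have "dist (char (distr M borel (X n)) t) (char (centered_gaussian \<sigma>) t)
          \<le> dist (char (distr M borel (X n)) t) (p n k) + dist (p n k) (q k)
            + dist (q k) (char (centered_gaussian \<sigma>) t)"
        using dist_triangle[of _ _ "p n k"] dist_triangle[of "p n k" _ "q k"]
        by (smt (verit))
      also have "\<dots> < \<epsilon>"
        using elim X_approx[of n k] G_approx[of k] k \<open>\<epsilon> > 0\<close>
        by (simp add: dist_norm norm_minus_commute)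
      finally show ?case .
    qed
  qed
qed

section \<open>Clusters and mixing\<close>

text \<open>
  Starting from singletons, merge two representatives as long as some pair is closer than the current threshold
  \<open>E j\<close>; each merge lowers the number of clusters and raises the radius from \<open>D j\<close> to \<open>D (j + 1)\<close>. The case of a
  single cluster is included.
\<close>

lemma clusters_exist:
  fixes h :: "nat \<Rightarrow> 'h::metric_space" and D E :: "nat \<Rightarrow> real"
  assumes S: "finite S" "S \<noteq> {}" and D: "D 0 = 0" "\<And>j. D (Suc j) = D j + E j" and E: "\<And>j. E j \<ge> 0"
  shows "\<exists>j<card S. \<exists>p. (\<forall>i\<in>S. dist (h i) (h (p i)) \<le> D j) \<and>
           (\<forall>u\<in>p ` S. \<forall>v\<in>p ` S. u \<noteq> v \<longrightarrow> E j < dist (h u) (h v))"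
proof -
  \<comment> \<open>The number of clusters plus \<open>j\<close> never exceeds
    \<open>card S\<close>; at least one cluster always remains, hence
    \<open>j < card S\<close>.\<close>
  have "?thesis" if "card (p ` S) + j \<le> card S" "\<forall>i\<in>S. dist (h i) (h (p i)) \<le> D j" for p j
    using that
  proof (induction "card (p ` S)" arbitrary: p j rule: less_induct)
    case less
    show ?case
    proof (cases "\<forall>u\<in>p ` S. \<forall>v\<in>p ` S. u \<noteq> v \<longrightarrow> E j < dist (h u) (h v)")
      case True
      have "card (p ` S) > 0" using S by (simp add: card_gt_0_iff)
      then show ?thesis using True less.prems by (intro exI[of _ j] conjI exI[of _ p]) auto
    next
      case False
      then obtain u v where uv: "u \<in> p ` S" "v \<in> p ` S" "u \<noteq> v" "dist (h u) (h v) \<le> E j"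
        by (auto simp: not_less)
      \<comment> \<open>The cluster represented by \<open>v\<close> is handed over to
        \<open>u\<close>, which costs its members at most \<open>E j\<close> in distance.\<close>
      define p' where "p' i = (if p i = v then u else p i)" for i
      have "p' ` S \<subseteq> p ` S - {v}" using uv by (auto simp: p'_def)
      then have "card (p' ` S) \<le> card (p ` S - {v})" using S by (intro card_mono) auto
      also have "\<dots> < card (p ` S)" using S uv by (intro card_Diff1_less) auto
      finally have lt: "card (p' ` S) < card (p ` S)" .
      have "dist (h i) (h (p' i)) \<le> D (Suc j)" if "i \<in> S" for i
      proof (cases "p i = v")
        case True
        then show ?thesis
          using dist_triangle[of "h i" "h u" "h v"] uv(4) less.prems(2) that
          by (force simp: p'_def D(2) dist_commute)
      next
        case False
        have "dist (h i) (h (p i)) \<le> D j" using less.prems(2) that by blast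
        then show ?thesis using E[of j] False by (simp add: p'_def D(2))
      qed
      then show ?thesis
        using less.prems(1) lt by (intro less.hyps[of p' "Suc j"]) auto
    qed
  qed
  from this[of id 0] show ?thesis using D(1) by simp
qed

lemma (in finite_measure) abs_integral_le_const:
  fixes F :: "'a \<Rightarrow> real"
  assumes "F \<in> borel_measurable M" "\<And>x. x \<in> space M \<Longrightarrow> \<bar>F x\<bar> \<le> b"
  shows "\<bar>\<integral>x. F x \<partial>M\<bar> \<le> b * measure M (space M)"
proof -
  have int: "integrable M F"
    using assms by (intro integrable_const_bound[where B = b]) auto
  have "\<bar>\<integral>x. F x \<partial>M\<bar> \<le> (\<integral>x. \<bar>F x\<bar> \<partial>M)"
    using integral_norm_bound[of M F] by simp
  also have "\<dots> \<le> (\<integral>x. b \<partial>M)"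
    using assms int by (intro integral_mono) auto
  finally show ?thesis by (simp add: mult.commute)
qed

section \<open>The action on functions, seminorms of products and uniform mixing\<close>

locale mixing_action = prob_space M
  for M :: "'x measure" +
  fixes a :: "'h::{group_add, metric_space, second_countable_topology} \<Rightarrow> 'x \<Rightarrow> 'x"
    and A :: "('x \<Rightarrow> real) set"
    and N :: "nat \<Rightarrow> ('x \<Rightarrow> real) \<Rightarrow> real"
  assumes H: "lcsc_group_left_inv_metric TYPE('h)"
    and act: "mp_action a M"
    and alg: "inv_subalgebra a M A"
    and semi: "seminorm_family a M A N"
    and mix: "exp_mixing_all_orders a M A N"
begin

text \<open>Left invariance turns the distance between two points of a cluster into a distance to
  the identity, which is what governs the growth of \<open>N s\<close>.\<close>

lemma dist_left_translate: "dist (- g + h) 0 = dist h (g :: 'h)"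
proof -
  have "dist (g + (- g + h)) (g + 0) = dist (- g + h) 0"
    using H unfolding lcsc_group_left_inv_metric_def by blast
  then show ?thesis by (simp add: add.assoc[symmetric])
qed

lemma measurable_act [measurable]: "a h \<in> M \<rightarrow>\<^sub>M M"
  using act by (simp add: mp_action_def)

lemma measurable_fun_act [measurable]:
  "F \<in> borel_measurable M \<Longrightarrow> fun_act a h F \<in> borel_measurable M"
  unfolding fun_act_def using measurable_compose[OF measurable_act] by blast

lemma algebra_measurable: "F \<in> A \<Longrightarrow> F \<in> borel_measurable M"
  using alg by (simp add: inv_subalgebra_def)

lemma fun_act_in_algebra: "F \<in> A \<Longrightarrow> fun_act a h F \<in> A"
  using alg by (simp add: inv_subalgebra_def)

lemma fun_act_add:
  assumes "x \<in> space M"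
  shows "fun_act a h (fun_act a k F) x = fun_act a (h + k) F x"
proof -
  have "a (- k + - h) x = a (- k) (a (- h) x)" using act assms unfolding mp_action_def by blast
  then show ?thesis by (simp only: fun_act_def minus_add)
qed

lemma integral_fun_act:
  assumes "F \<in> borel_measurable M"
  shows "integral\<^sup>L M (fun_act a h F) = integral\<^sup>L M F"
proof -
  have "distr M M (a (- h)) = M" using act by (simp add: mp_action_def)
  then have "integral\<^sup>L M F = integral\<^sup>L (distr M M (a (- h))) F" by simp
  also have "\<dots> = integral\<^sup>L M (fun_act a h F)"
    unfolding fun_act_def by (rule integral_distr) (use assms in auto)
  finally show ?thesis ..
qed

lemma AE_fun_act:
  assumes "AE x in M. P x"
  shows "AE x in M. P (a h x)"
proof -
  have "distr M M (a h) = M" using act by (simp add: mp_action_def)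
  then have "AE x in distr M M (a h). P x" using assms by (simp only:)
  then show ?thesis by (rule AE_distrD[OF measurable_act])
qed

text \<open>The empty product is excluded because \<open>A\<close> is not assumed to contain the
  constant 1.\<close>

lemma prod_in_algebra:
  assumes "finite J" "J \<noteq> {}" "\<And>i. i \<in> J \<Longrightarrow> F i \<in> A"
  shows "(\<lambda>x. \<Prod>i\<in>J. F i x) \<in> A"
  using assms
proof (induction J rule: finite_ne_induct)
  case (insert i J)
  then show ?case using alg by (simp add: inv_subalgebra_def)
qed simp

lemma seminorm_nonneg: "s \<ge> 1 \<Longrightarrow> F \<in> A \<Longrightarrow> N s F \<ge> 0"
  using semi unfolding seminorm_family_def by blast

text \<open>Each multiplication raises the order of the seminorm by one, so the induction on the
  number of factors keeps \<open>s\<close> arbitrary. The bound \<open>C \<ge> 1\<close> makes the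
  right-hand side at least 1, which later allows powers of it to be enlarged.\<close>

lemma seminorm_prod_translates:
  assumes f: "f \<in> A" and s: "s \<ge> 1"
  shows "\<exists>C\<ge>1. \<exists>K\<ge>0. \<forall>(J::nat set) k D. finite J \<longrightarrow> J \<noteq> {} \<longrightarrow> card J \<le> n \<longrightarrow> D \<ge> 0 \<longrightarrow>
    (\<forall>i\<in>J. dist (k i) 0 \<le> D) \<longrightarrow> N s (\<lambda>x. \<Prod>i\<in>J. fun_act a (k i) f x) \<le> C * exp (K * D)"
  using s
proof (induction n arbitrary: s)
  case 0
  then show ?case by (intro exI[of _ 1] exI[of _ 0]) auto
next
  case (Suc n)
  have single: "\<exists>C\<ge>1. \<exists>K\<ge>0. \<forall>h D. D \<ge> 0 \<longrightarrow> dist h 0 \<le> D \<longrightarrow> N s (fun_act a h f) \<le> C * exp (K * D)"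
    if s1: "s \<ge> 1" for s
  proof -
    obtain \<sigma> C where sC: "\<sigma> > 0" "\<And>F h. F \<in> A \<Longrightarrow> N s (fun_act a h F) \<le> C * exp (\<sigma> * dist h 0) * N s F"
      using semi s1 unfolding seminorm_family_def by metis
    have "N s (fun_act a h f) \<le> (1 + \<bar>C\<bar> * N s f) * exp (\<sigma> * D)" if "D \<ge> 0" "dist h 0 \<le> D" for h D
    proof -
      have "N s (fun_act a h f) \<le> C * exp (\<sigma> * dist h 0) * N s f" using sC(2) f by blast
      also have "\<dots> \<le> \<bar>C\<bar> * exp (\<sigma> * D) * N s f"
        using sC(1) that seminorm_nonneg[OF s1 f] by (intro mult_mono mult_nonneg_nonneg) auto
      also have "\<dots> \<le> (1 + \<bar>C\<bar> * N s f) * exp (\<sigma> * D)" by (simp add: algebra_simps)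
      finally show ?thesis .
    qed
    then show ?thesis
      using sC(1) seminorm_nonneg[OF s1 f]
      by (intro exI[of _ "1 + \<bar>C\<bar> * N s f"] conjI exI[of _ \<sigma>]) auto
  qed
  obtain C1 K1 where 1: "C1 \<ge> 1" "K1 \<ge> 0"
    "\<And>h D. D \<ge> 0 \<Longrightarrow> dist h 0 \<le> D \<Longrightarrow> N s (fun_act a h f) \<le> C1 * exp (K1 * D)"
    using single[OF Suc.prems] by metis
  obtain C2 K2 where 2: "C2 \<ge> 1" "K2 \<ge> 0"
    "\<And>h D. D \<ge> 0 \<Longrightarrow> dist h 0 \<le> D \<Longrightarrow> N (s + 1) (fun_act a h f) \<le> C2 * exp (K2 * D)"
    using single[of "s + 1"] by (metis le_add2)
  obtain C3 K3 where 3: "C3 \<ge> 1" "K3 \<ge> 0"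
    "\<And>J k D. finite (J::nat set) \<Longrightarrow> J \<noteq> {} \<Longrightarrow> card J \<le> n \<Longrightarrow> D \<ge> 0 \<Longrightarrow> \<forall>i\<in>J. dist (k i) 0 \<le> D \<Longrightarrow>
       N (s + 1) (\<lambda>x. \<Prod>i\<in>J. fun_act a (k i) f x) \<le> C3 * exp (K3 * D)"
    using Suc.IH[of "s + 1"] by (metis le_add2)
  obtain C4 where 4: "\<And>f1 f2. f1 \<in> A \<Longrightarrow> f2 \<in> A \<Longrightarrow> N s (\<lambda>x. f1 x * f2 x) \<le> C4 * N (s + 1) f1 * N (s + 1) f2"
    using semi Suc.prems unfolding seminorm_family_def by metis
  \<comment> \<open>Sums, so that one pair of constants covers both a single factor and the split
    into one factor and the rest.\<close>
  define C where "C = C1 + \<bar>C4\<bar> * (C2 * C3)"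
  define K where "K = K1 + (K2 + K3)"
  have "N s (\<lambda>x. \<Prod>i\<in>J. fun_act a (k i) f x) \<le> C * exp (K * D)"
    if J: "finite J" "J \<noteq> {}" "card J \<le> Suc n" "D \<ge> 0" "\<forall>i\<in>J. dist (k i) 0 \<le> D" for J :: "nat set" and k D
  proof -
    obtain i where i: "i \<in> J" using J by blast
    define J' where "J' = J - {i}"
    have J': "J = insert i J'" "i \<notin> J'" "finite J'" using i J by (auto simp: J'_def)
    have CK: "c * exp (\<kappa> * D) \<le> C * exp (K * D)" if "0 \<le> c" "c \<le> C" "\<kappa> \<le> K" for c \<kappa>
      using that J(4) by (intro mult_mono) (auto intro: mult_right_mono)
    show ?thesis
    proof (cases "J' = {}")
      case True
      then show ?thesis
        using 1(3)[OF J(4), of "k i"] J(5) i CK[of C1 K1] 1 2 3 J'(1) by (force simp: C_def K_def)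
    next
      case False
      let ?F = "\<lambda>x. \<Prod>i\<in>J'. fun_act a (k i) f x"
      have F: "?F \<in> A" using J' False f by (intro prod_in_algebra fun_act_in_algebra) auto
      have "N s (\<lambda>x. \<Prod>i\<in>J. fun_act a (k i) f x) = N s (\<lambda>x. fun_act a (k i) f x * ?F x)"
        using J' by simp
      also have "\<dots> \<le> C4 * N (s + 1) (fun_act a (k i) f) * N (s + 1) ?F"
        using 4[OF fun_act_in_algebra[OF f] F] .
      also have "\<dots> \<le> \<bar>C4\<bar> * (C2 * exp (K2 * D)) * (C3 * exp (K3 * D))"
      proof (intro mult_mono mult_nonneg_nonneg)
        show "N (s + 1) (fun_act a (k i) f) \<le> C2 * exp (K2 * D)" using J i by (intro 2) auto
        show "N (s + 1) ?F \<le> C3 * exp (K3 * D)" using J J' False by (intro 3) auto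
        show "0 \<le> N (s + 1) (fun_act a (k i) f)"
          by (rule seminorm_nonneg) (use fun_act_in_algebra[OF f] in auto)
        show "0 \<le> N (s + 1) ?F" by (rule seminorm_nonneg) (use F in auto)
      qed (use 2 in auto)
      also have "\<dots> = \<bar>C4\<bar> * (C2 * C3) * exp ((K2 + K3) * D)"
        by (simp add: distrib_right exp_add)
      also have "\<dots> \<le> C * exp (K * D)" using 1 2 3 by (intro CK) (auto simp: C_def K_def)
      finally show ?thesis .
    qed
  qed
  moreover have "C \<ge> 1" using 1 2 3 by (simp add: C_def add_increasing2)
  moreover have "K \<ge> 0" using 1 2 3 by (simp add: K_def)
  ultimately show ?case by blast
qed

text \<open>Clustering leaves a varying number of clusters, hence one choice of
  \<open>\<delta>\<close>, \<open>s\<close> and \<open>C\<close> for all orders up to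
  \<open>r\<close> and an arbitrary index set. Orders 0 and 1 are trivial, the latter by invariance
  of the measure.\<close>

lemma mixing_bounded_order:
  "\<exists>\<delta>>0. \<exists>s\<ge>1. \<exists>C\<ge>0. \<forall>(R::nat set) F k E. finite R \<longrightarrow> card R \<le> r \<longrightarrow> (\<forall>u\<in>R. F u \<in> A) \<longrightarrow> E \<ge> 0 \<longrightarrow>
     (\<forall>u\<in>R. \<forall>v\<in>R. u \<noteq> v \<longrightarrow> E < dist (k u) (k v)) \<longrightarrow>
     \<bar>(\<integral>x. (\<Prod>u\<in>R. fun_act a (k u) (F u) x) \<partial>M) - (\<Prod>u\<in>R. \<integral>x. F u x \<partial>M)\<bar>
       \<le> C * exp (- \<delta> * E) * (\<Prod>u\<in>R. N s (F u))"
proof -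
  define bd where "bd q \<delta> s C \<longleftrightarrow> (\<forall>fs::nat \<Rightarrow> 'x \<Rightarrow> real. \<forall>hs::nat \<Rightarrow> 'h. (\<forall>i<q. fs i \<in> A) \<longrightarrow>
        \<bar>(\<integral>x. (\<Prod>i<q. fun_act a (hs i) (fs i) x) \<partial>M) - (\<Prod>i<q. \<integral>x. fs i x \<partial>M)\<bar>
          \<le> C * exp (- \<delta> * Min {dist (hs i) (hs j) | i j. i < q \<and> j < q \<and> i \<noteq> j}) * (\<Prod>i<q. N s (fs i)))"
    for q \<delta> s C
  have "\<forall>q\<ge>2. \<exists>\<delta>>0. \<exists>sr::nat>0. \<forall>s>sr. \<exists>C. bd q \<delta> s C"
    using mix unfolding exp_mixing_all_orders_def bd_def .
  then obtain \<delta> sr where ds: "\<And>q. q \<ge> 2 \<Longrightarrow> \<delta> q > 0" "\<And>q s. q \<ge> 2 \<Longrightarrow> s > sr q \<Longrightarrow> \<exists>C. bd q (\<delta> q) s C"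
    by metis
  \<comment> \<open>Exceeds every threshold \<open>sr q\<close> with
    \<open>q \<le> r\<close>.\<close>
  define s where "s = 1 + (\<Sum>q\<le>r. sr q)"
  have "s > sr q" if "q \<le> r" for q
    using member_le_sum[of q "{..r}" sr] that by (simp add: s_def)
  then have "\<forall>q. q \<ge> 2 \<and> q \<le> r \<longrightarrow> (\<exists>C. bd q (\<delta> q) s C)" using ds(2) by blast
  then obtain C where C: "\<And>q. q \<ge> 2 \<Longrightarrow> q \<le> r \<Longrightarrow> bd q (\<delta> q) s (C q)" by metis
  \<comment> \<open>The inserted 1 keeps the minimum meaningful and positive when
    \<open>r < 2\<close>.\<close>
  define \<delta>' where "\<delta>' = Min (insert 1 (\<delta> ` {2..r}))"
  define C' where "C' = (\<Sum>q\<le>r. \<bar>C q\<bar>)"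
  have d': "\<delta>' > 0" using ds(1) by (auto simp: \<delta>'_def)
  have C': "C' \<ge> 0" by (simp add: C'_def sum_nonneg)
  have "\<bar>(\<integral>x. (\<Prod>u\<in>R. fun_act a (k u) (F u) x) \<partial>M) - (\<Prod>u\<in>R. \<integral>x. F u x \<partial>M)\<bar>
       \<le> C' * exp (- \<delta>' * E) * (\<Prod>u\<in>R. N s (F u))"
    if R: "finite R" "card R \<le> r" "\<forall>u\<in>R. F u \<in> A" "E \<ge> 0" "\<forall>u\<in>R. \<forall>v\<in>R. u \<noteq> v \<longrightarrow> E < dist (k u) (k v)"
    for R :: "nat set" and F k E
  proof -
    have Nn: "N s (F u) \<ge> 0" if "u \<in> R" for u using R that by (intro seminorm_nonneg) (auto simp: s_def)
    have RHS: "0 \<le> C' * exp (- \<delta>' * E) * (\<Prod>u\<in>R. N s (F u))"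
      using C' Nn by (intro mult_nonneg_nonneg prod_nonneg) auto
    consider "card R = 0" | "card R = 1" | "card R \<ge> 2" by linarith
    then show ?thesis
    proof cases
      case 1
      then have "R = {}" using R by simp
      then show ?thesis using RHS prob_space by simp
    next
      case 2
      then obtain u where u: "R = {u}" by (auto simp: card_1_singleton_iff)
      then have "F u \<in> A" using R(3) by simp
      then have "(\<integral>x. fun_act a (k u) (F u) x \<partial>M) = (\<integral>x. F u x \<partial>M)"
        by (intro integral_fun_act algebra_measurable)
      then show ?thesis using RHS u by simp
    next
      case 3
      define q where "q = card R"
      obtain e where e: "bij_betw e {..<q} R"
        using ex_bij_betw_nat_finite[OF R(1)] by (auto simp: q_def atLeast0LessThan)
      have eR: "e i \<in> R" if "i < q" for i using e that by (auto simp: bij_betw_def)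
      have einj: "e i \<noteq> e j" if "i < q" "j < q" "i \<noteq> j" for i j
        using e that by (auto simp: bij_betw_def inj_on_def)
      let ?X = "{dist (k (e i)) (k (e j)) | i j. i < q \<and> j < q \<and> i \<noteq> j}"
      \<comment> \<open>\<open>Min\<close> is informative only on a finite nonempty set; there is a
        pair of distinct indices because \<open>q \<ge> 2\<close>.\<close>
      have "?X \<subseteq> (\<lambda>(i, j). dist (k (e i)) (k (e j))) ` ({..<q} \<times> {..<q})" by auto
      then have "finite ?X" by (rule finite_subset) auto
      moreover have "dist (k (e 0)) (k (e 1)) \<in> ?X" using 3 by (force simp: q_def)
      then have "?X \<noteq> {}" by blast
      ultimately have Min: "Min ?X \<ge> E"
        using R(5) eR einj by (auto simp: less_imp_le)
      have "0 < \<delta> q" using 3 ds(1) by (simp add: q_def)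
      moreover have "\<delta>' \<le> \<delta> q"
        unfolding \<delta>'_def using 3 R(2) by (intro Min_le) (auto simp: q_def)
      ultimately have dq: "\<delta>' \<le> \<delta> q" "0 < \<delta> q" by auto
      have "\<delta>' * E \<le> \<delta> q * Min ?X" using dq d' Min R(4) by (intro mult_mono) auto
      then have exp: "exp (- \<delta> q * Min ?X) \<le> exp (- \<delta>' * E)" by simp
      have "\<bar>C q\<bar> \<le> C'" using R(2) unfolding C'_def q_def
        by (intro member_le_sum[of _ _ "\<lambda>q. \<bar>C q\<bar>"]) auto
      then have Cq: "C q \<le> C'" by linarith
      have bd: "bd q (\<delta> q) s (C q)" using 3 R(2) by (intro C) (auto simp: q_def)
      have re: "(\<Prod>u\<in>R. G u) = (\<Prod>i<q. G (e i))" for G :: "nat \<Rightarrow> real"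
        using prod.reindex_bij_betw[OF e, of G] by simp
      have "\<bar>(\<integral>x. (\<Prod>u\<in>R. fun_act a (k u) (F u) x) \<partial>M) - (\<Prod>u\<in>R. \<integral>x. F u x \<partial>M)\<bar>
          \<le> C q * exp (- \<delta> q * Min ?X) * (\<Prod>u\<in>R. N s (F u))"
        using bd[unfolded bd_def, rule_format, of "\<lambda>i. F (e i)" "\<lambda>i. k (e i)"] eR R(3)
        unfolding re by blast
      also have "\<dots> \<le> C' * exp (- \<delta>' * E) * (\<Prod>u\<in>R. N s (F u))"
        using exp Cq C' Nn by (intro mult_mono mult_right_mono prod_nonneg) auto
      finally show ?thesis .
    qed
  qed
  then show ?thesis
    using d' C' by (intro exI[of _ \<delta>'] conjI exI[of _ s] exI[of _ C']) (auto simp: s_def)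
qed

section \<open>Correlations of translates and their cumulants\<close>

definition correlation :: "('x \<Rightarrow> real) \<Rightarrow> (nat \<Rightarrow> 'h) \<Rightarrow> nat set \<Rightarrow> real" where
  "correlation f h S = (\<integral>x. (\<Prod>i\<in>S. fun_act a (h i) f x) \<partial>M)"

lemma correlation_empty [simp]: "correlation f h {} = 1"
  using prob_space by (simp add: correlation_def)

text \<open>Translations preserve null sets, and only finitely many of them occur.\<close>

lemma correlation_cong_AE:
  assumes "AE x in M. f x = g x" "f \<in> borel_measurable M" "g \<in> borel_measurable M" "finite S"
  shows "correlation f h S = correlation g h S"
proof -
  have "AE x in M. \<forall>i\<in>S. fun_act a (h i) f x = fun_act a (h i) g x"
    using assms(4) unfolding fun_act_def
    by (intro AE_finite_allI AE_fun_act[OF assms(1)])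
  then have "AE x in M. (\<Prod>i\<in>S. fun_act a (h i) f x) = (\<Prod>i\<in>S. fun_act a (h i) g x)"
    by eventually_elim (auto intro: prod.cong)
  then show ?thesis
    unfolding correlation_def using assms(2,3)
    by (intro integral_cong_AE borel_measurable_prod measurable_fun_act)
qed

lemma correlation_bounded:
  assumes g: "g \<in> borel_measurable M" "\<And>x. \<bar>g x\<bar> \<le> b" "b \<ge> 1" and S: "finite S" "card S \<le> r"
  shows "\<bar>correlation g h S\<bar> \<le> b ^ r"
proof -
  have "\<bar>\<Prod>i\<in>S. fun_act a (h i) g x\<bar> \<le> b ^ r" for x
  proof -
    have "\<bar>\<Prod>i\<in>S. fun_act a (h i) g x\<bar> \<le> (\<Prod>i\<in>S. b)"
      unfolding abs_prod using g(2) by (intro prod_mono) (auto simp: fun_act_def)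
    also have "\<dots> \<le> b ^ r" using S g(3) by (simp add: power_increasing)
    finally show ?thesis .
  qed
  then show ?thesis
    unfolding correlation_def
    using abs_integral_le_const[of "\<lambda>x. \<Prod>i\<in>S. fun_act a (h i) g x" "b ^ r"] g(1)
    by (simp add: prob_space)
qed

text \<open>The factors of one cluster, translated back by its representative, form one element of
  \<open>A\<close> of seminorm at most exponential in the radius \<open>D\<close>. Mixing these
  elements at the representatives, which are \<open>E\<close>-separated, gives the gain
  \<open>exp (- \<delta> * E)\<close>.\<close>

lemma correlation_clusters:
  assumes f: "f \<in> A"
  shows "\<exists>\<delta>>0. \<exists>K\<ge>0. \<exists>C\<ge>0. \<forall>J p h D E. finite J \<longrightarrow> card J \<le> r \<longrightarrow> D \<ge> 0 \<longrightarrow> E \<ge> 0 \<longrightarrow>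
     (\<forall>i\<in>J. dist (h i) (h (p i)) \<le> D) \<longrightarrow>
     (\<forall>u\<in>p ` J. \<forall>v\<in>p ` J. u \<noteq> v \<longrightarrow> E < dist (h u) (h v)) \<longrightarrow>
     \<bar>correlation f h J - (\<Prod>u\<in>p ` J. correlation f h {i \<in> J. p i = u})\<bar> \<le> C * exp (K * D - \<delta> * E)"
proof -
  obtain \<delta> s C where mx: "\<delta> > 0" "s \<ge> 1" "C \<ge> 0"
     "\<forall>(R::nat set) F k E. finite R \<longrightarrow> card R \<le> r \<longrightarrow> (\<forall>u\<in>R. F u \<in> A) \<longrightarrow> E \<ge> 0 \<longrightarrow>
     (\<forall>u\<in>R. \<forall>v\<in>R. u \<noteq> v \<longrightarrow> E < dist (k u) (k v)) \<longrightarrow>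
     \<bar>(\<integral>x. (\<Prod>u\<in>R. fun_act a (k u) (F u) x) \<partial>M) - (\<Prod>u\<in>R. \<integral>x. F u x \<partial>M)\<bar>
       \<le> C * exp (- \<delta> * E) * (\<Prod>u\<in>R. N s (F u))"
    using mixing_bounded_order[of r]
    by (elim exE conjE) (rule that)
  obtain B K where B: "B \<ge> 1" "K \<ge> 0" "\<And>J k D. finite (J::nat set) \<Longrightarrow> J \<noteq> {} \<Longrightarrow> card J \<le> r \<Longrightarrow> D \<ge> 0 \<Longrightarrow>
       \<forall>i\<in>J. dist (k i) 0 \<le> D \<Longrightarrow> N s (\<lambda>x. \<Prod>i\<in>J. fun_act a (k i) f x) \<le> B * exp (K * D)"
    using seminorm_prod_translates[OF f mx(2), of r] by metis
  have main: "\<bar>correlation f h J - (\<Prod>u\<in>p ` J. correlation f h {i \<in> J. p i = u})\<bar>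
      \<le> C * B ^ r * exp ((real r * K) * D - \<delta> * E)"
    if J: "finite J" "card J \<le> r" "D \<ge> 0" "E \<ge> 0" "\<forall>i\<in>J. dist (h i) (h (p i)) \<le> D"
      "\<forall>u\<in>p ` J. \<forall>v\<in>p ` J. u \<noteq> v \<longrightarrow> E < dist (h u) (h v)" for J p h D E
  proof -
    \<comment> \<open>The product over the cluster of \<open>u\<close>, seen from
      \<open>h u\<close>: all its translations lie within \<open>D\<close> of the identity.\<close>
    define F where "F u = (\<lambda>x. \<Prod>i\<in>{i \<in> J. p i = u}. fun_act a (- h u + h i) f x)" for u
    have FA: "F u \<in> A" if "u \<in> p ` J" for u
      unfolding F_def using that J(1) f by (intro prod_in_algebra fun_act_in_algebra) auto
    have act_F: "fun_act a (h u) (F u) x = (\<Prod>i\<in>{i \<in> J. p i = u}. fun_act a (h i) f x)"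
      if "x \<in> space M" for u x
    proof -
      have "fun_act a (h u) (F u) x = (\<Prod>i\<in>{i \<in> J. p i = u}. fun_act a (h u) (fun_act a (- h u + h i) f) x)"
        by (simp add: F_def fun_act_def)
      then show ?thesis using that by (simp add: fun_act_add add.assoc[symmetric])
    qed
    have int_F: "(\<integral>x. F u x \<partial>M) = correlation f h {i \<in> J. p i = u}" if "u \<in> p ` J" for u
    proof -
      have "(\<integral>x. F u x \<partial>M) = (\<integral>x. fun_act a (h u) (F u) x \<partial>M)"
        using integral_fun_act[OF algebra_measurable[OF FA[OF that]]] by simp
      also have "\<dots> = correlation f h {i \<in> J. p i = u}"
        unfolding correlation_def by (intro Bochner_Integration.integral_cong refl act_F)
      finally show ?thesis .
    qed
    have "correlation f h J = (\<integral>x. (\<Prod>u\<in>p ` J. fun_act a (h u) (F u) x) \<partial>M)"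
      unfolding correlation_def
    proof (intro Bochner_Integration.integral_cong refl)
      fix x assume x: "x \<in> space M"
      show "(\<Prod>i\<in>J. fun_act a (h i) f x) = (\<Prod>u\<in>p ` J. fun_act a (h u) (F u) x)"
        unfolding act_F[OF x] by (rule prod.image_gen[OF J(1)])
    qed
    moreover have "(\<Prod>u\<in>p ` J. correlation f h {i \<in> J. p i = u}) = (\<Prod>u\<in>p ` J. \<integral>x. F u x \<partial>M)"
      by (intro prod.cong refl) (simp add: int_F)
    moreover have card: "card (p ` J) \<le> r" using card_image_le[OF J(1), of p] J(2) by linarith
    ultimately have "\<bar>correlation f h J - (\<Prod>u\<in>p ` J. correlation f h {i \<in> J. p i = u})\<bar>
        \<le> C * exp (- \<delta> * E) * (\<Prod>u\<in>p ` J. N s (F u))"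
      using mx(4)[rule_format, of "p ` J" F E h] J FA by auto
    also have "(\<Prod>u\<in>p ` J. N s (F u)) \<le> (\<Prod>u\<in>p ` J. B * exp (K * D))"
    proof (intro prod_mono conjI)
      fix u assume u: "u \<in> p ` J"
      show "0 \<le> N s (F u)" using FA[OF u] mx(2) by (rule seminorm_nonneg[rotated])
      have "card {i \<in> J. p i = u} \<le> card J" using J(1) by (intro card_mono) auto
      then show "N s (F u) \<le> B * exp (K * D)"
        unfolding F_def using J u by (intro B(3)) (auto simp: dist_left_translate)
    qed
    also have "\<dots> \<le> (B * exp (K * D)) ^ r"
    proof -
      \<comment> \<open>With base at least 1, the exponent, which is the number of clusters, may be
        raised to \<open>r\<close>.\<close>
      have "B * exp (K * D) \<ge> 1 * 1" using B J(3) by (intro mult_mono) auto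
      then show ?thesis using card by (simp add: power_increasing)
    qed
    also have "\<dots> = B ^ r * exp (real r * K * D)"
      by (simp add: power_mult_distrib exp_of_nat_mult[symmetric] mult.assoc)
    finally have "\<bar>correlation f h J - (\<Prod>u\<in>p ` J. correlation f h {i \<in> J. p i = u})\<bar>
        \<le> C * exp (- \<delta> * E) * (B ^ r * exp (real r * K * D))"
      using mx(3) by (simp add: mult_left_mono)
    then show ?thesis by (simp add: exp_diff exp_minus field_simps)
  qed
  have "C * B ^ r \<ge> 0" "real r * K \<ge> 0" using mx B by auto
  then show ?thesis
    using mx(1)
    by (intro exI[of _ \<delta>] conjI exI[of _ "real r * K"] exI[of _ "C * B ^ r"] allI impI main)
qed

text \<open>Two points at distance \<open>c * L\<close> fall into different clusters, so all
  correlations nearly factorize across one cluster and its complement, and the cumulant is small.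
  The rate \<open>real r + 1\<close> is chosen so that, at \<open>L\<close> the logarithm of the
  mass, the bound still decays after integration over \<open>r\<close> copies of the group.\<close>

lemma cumulant_correlation_spread:
  assumes f: "f \<in> A" and r: "r \<ge> 1"
    and b: "b \<ge> 1" "\<And>h J. finite J \<Longrightarrow> card J \<le> r \<Longrightarrow> \<bar>correlation f h J\<bar> \<le> b"
  shows "\<exists>c>0. \<exists>G\<ge>0. \<forall>S h L. card S = r \<longrightarrow> L > 0 \<longrightarrow>
     (\<exists>i\<in>S. \<exists>j\<in>S. c * L \<le> dist (h i) (h j)) \<longrightarrow> \<bar>cumulant (correlation f h) S\<bar> \<le> G * exp (- (real r + 1) * L)"
proof -
  obtain \<delta> K C where cl: "\<delta> > 0" "K \<ge> 0" "C \<ge> 0"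
    "\<forall>J p h D E. finite J \<longrightarrow> card J \<le> r \<longrightarrow> D \<ge> 0 \<longrightarrow> E \<ge> 0 \<longrightarrow>
     (\<forall>i\<in>J. dist (h i) (h (p i)) \<le> D) \<longrightarrow>
     (\<forall>u\<in>p ` J. \<forall>v\<in>p ` J. u \<noteq> v \<longrightarrow> E < dist (h u) (h v)) \<longrightarrow>
     \<bar>correlation f h J - (\<Prod>u\<in>p ` J. correlation f h {i \<in> J. p i = u})\<bar> \<le> C * exp (K * D - \<delta> * E)"
    using correlation_clusters[OF f, of r]
    by (elim exE conjE) (rule that)
  obtain G where G: "G \<ge> 0" "\<And>S m U \<epsilon>. finite S \<Longrightarrow> card S \<le> r \<Longrightarrow> m {} = 1 \<Longrightarrow> \<forall>J\<subseteq>S. \<bar>m J\<bar> \<le> b \<Longrightarrow>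
     S \<inter> U \<noteq> {} \<Longrightarrow> S - U \<noteq> {} \<Longrightarrow> \<forall>J\<subseteq>S. \<bar>m J - m (J \<inter> U) * m (J - U)\<bar> \<le> \<epsilon> \<Longrightarrow>
     \<bar>cumulant m S\<bar> \<le> G * \<epsilon>"
    using cumulant_almost_factorizing[OF order_trans[OF zero_le_one b(1)], of r] by blast
  \<comment> \<open>\<open>w\<close> solves \<open>K x - \<delta> w = - (r + 1)\<close>: separation \<open>w(d\<^sub>j) L\<close> beats clusters of radius \<open>d\<^sub>j L\<close>.\<close>
  define w where "w x = ((real r + 1) + K * x) / \<delta>" for x
  define d where "d = rec_nat 0 (\<lambda>_ x. x + w x)"
  have d: "d 0 = 0" "d (Suc j) = d j + w (d j)" for j by (simp_all add: d_def)
  have d0: "d j \<ge> 0" for j by (induction j) (use d cl in \<open>auto simp: w_def\<close>)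
  have w0: "w (d j) \<ge> 0" for j using d0 cl by (simp add: w_def)
  have "incseq d" using w0 by (intro incseq_SucI) (simp add: d(2))
  \<comment> \<open>Two points of one cluster are at most \<open>2 * d r * L\<close> apart; the
    added 1 makes the comparison strict.\<close>
  define c where "c = 2 * d r + 1"
  have "\<bar>cumulant (correlation f h) S\<bar> \<le> G * (C * (1 + b)) * exp (- (real r + 1) * L)"
    if S: "card S = r" and L: "L > 0" and far: "\<exists>i\<in>S. \<exists>j\<in>S. c * L \<le> dist (h i) (h j)" for S h L
  proof -
    have S0: "finite S" "S \<noteq> {}" using S r by (auto intro: card_ge_0_finite)
    obtain j p where jp: "j < r" "\<forall>i\<in>S. dist (h i) (h (p i)) \<le> d j * L"
      "\<forall>u\<in>p ` S. \<forall>v\<in>p ` S. u \<noteq> v \<longrightarrow> w (d j) * L < dist (h u) (h v)"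
      using clusters_exist[OF S0, of "\<lambda>j. d j * L" "\<lambda>j. w (d j) * L" h] S L w0
      by (auto simp: d distrib_right)
    obtain i i' where ii: "i \<in> S" "i' \<in> S" "c * L \<le> dist (h i) (h i')" using far by blast
    have pne: "p i \<noteq> p i'"
    proof
      assume "p i = p i'"
      then have "dist (h i) (h i') \<le> 2 * (d j * L)"
        using dist_triangle2[of "h i" "h i'" "h (p i)"] bspec[OF jp(2) ii(1)] bspec[OF jp(2) ii(2)]
        by simp
      also have "\<dots> \<le> 2 * (d r * L)"
        using incseqD[OF \<open>incseq d\<close>, of j r] jp(1) L by simp
      also have "\<dots> < c * L" using L by (simp add: c_def algebra_simps)
      finally show False using ii by simp
    qed
    \<comment> \<open>The cluster of \<open>i\<close> is split off from all the others; it contains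
      \<open>i\<close> but not \<open>i'\<close>.\<close>
    define U where "U = {k. p k = p i}"
    define \<epsilon> where "\<epsilon> = C * exp (- (real r + 1) * L)"
    have eps: "\<bar>correlation f h J - (\<Prod>u\<in>p ` J. correlation f h {i \<in> J. p i = u})\<bar> \<le> \<epsilon>" if "J \<subseteq> S" for J
    proof -
      have "K * (d j * L) - \<delta> * (w (d j) * L) = - (real r + 1) * L"
        using cl(1) by (simp add: w_def field_simps)
      moreover have "card J \<le> r" using card_mono[OF S0(1) that] S by simp
      ultimately show ?thesis
        using cl(4)[rule_format, of J "d j * L" "w (d j) * L" h p] that jp finite_subset[OF that S0(1)] L d0[of j] w0[of j]
        unfolding \<epsilon>_def by (auto simp: subset_iff)
    qed
    have eps0: "\<epsilon> \<ge> 0" using cl by (simp add: \<epsilon>_def)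
    \<comment> \<open>The cluster expansion is used for \<open>J\<close> and for
      \<open>J - U\<close>: both sides are compared with the product over the clusters of
      \<open>J\<close>. The first error is \<open>\<epsilon>\<close>, the second is multiplied by a
      correlation of size at most \<open>b\<close>.\<close>
    have "\<bar>correlation f h J - correlation f h (J \<inter> U) * correlation f h (J - U)\<bar> \<le> (1 + b) * \<epsilon>" if J: "J \<subseteq> S" for J
    proof (cases "p i \<in> p ` J")
      case False
      then have "J \<inter> U = {}" "J - U = J" by (auto simp: U_def image_iff dest: sym)
      then show ?thesis using eps0 b(1) by simp
    next
      case True
      let ?P = "\<Prod>u\<in>p ` (J - U). correlation f h {i \<in> J - U. p i = u}"
      have finJ: "finite J" using finite_subset[OF J S0(1)] .
      have "p ` J = insert (p i) (p ` (J - U))" "p i \<notin> p ` (J - U)" "{k \<in> J. p k = p i} = J \<inter> U"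
        using True by (auto simp: U_def)
      then have "(\<Prod>u\<in>p ` J. correlation f h {i \<in> J. p i = u})
          = correlation f h (J \<inter> U) * (\<Prod>u\<in>p ` (J - U). correlation f h {i \<in> J. p i = u})"
        using finJ by simp
      also have "(\<Prod>u\<in>p ` (J - U). correlation f h {i \<in> J. p i = u}) = ?P"
        by (intro prod.cong arg_cong[where f = "correlation f h"]) (auto simp: U_def)
      finally have "\<bar>correlation f h J - correlation f h (J \<inter> U) * ?P\<bar> \<le> \<epsilon>"
        using eps[OF J] by simp
      moreover have "\<bar>correlation f h (J \<inter> U)\<bar> \<le> b"
        using finJ card_mono[of S "J \<inter> U"] S S0 J by (intro b) auto
      then have "\<bar>correlation f h (J \<inter> U) * (?P - correlation f h (J - U))\<bar> \<le> b * \<epsilon>"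
        using eps[of "J - U"] J eps0 b(1) unfolding abs_mult
        by (intro mult_mono) (auto simp: abs_minus_commute)
      ultimately show ?thesis
        by (simp add: right_diff_distrib distrib_right)
    qed
    moreover have "S \<inter> U \<noteq> {}" "S - U \<noteq> {}" using ii pne by (auto simp: U_def)
    moreover have "\<forall>J\<subseteq>S. \<bar>correlation f h J\<bar> \<le> b"
      using b(2) finite_subset[OF _ S0(1)] card_mono[OF S0(1)] S by auto
    ultimately have "\<bar>cumulant (correlation f h) S\<bar> \<le> G * ((1 + b) * \<epsilon>)"
      using S0 S by (intro G(2)[of S "correlation f h" U]) auto
    then show ?thesis by (simp add: \<epsilon>_def mult_ac)
  qed
  moreover have "c > 0" using d0[of r] by (simp add: c_def)
  moreover have "G * (C * (1 + b)) \<ge> 0" using G(1) cl(3) b(1) by simp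
  ultimately show ?thesis by blast
qed

end

section \<open>Integration over the group\<close>

text \<open>Both functions take full index families but read only the coordinates in
  \<open>I\<close> or in \<open>J\<close>. The same terms therefore make sense over all three
  product spaces, and Fubini separates them.\<close>

lemma (in product_sigma_finite) product_integral_mult_disjoint:
  fixes \<phi> \<psi> :: "('i \<Rightarrow> 'a) \<Rightarrow> real"
  assumes IJ: "I \<inter> J = {}" "finite I" "finite J"
    and int: "integrable (Pi\<^sub>M (I \<union> J) M) (\<lambda>h. \<phi> h * \<psi> h)"
    and \<phi>: "\<And>h h'. (\<And>i. i \<in> I \<Longrightarrow> h i = h' i) \<Longrightarrow> \<phi> h = \<phi> h'"
    and \<psi>: "\<And>h h'. (\<And>i. i \<in> J \<Longrightarrow> h i = h' i) \<Longrightarrow> \<psi> h = \<psi> h'"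
  shows "(\<integral>h. \<phi> h * \<psi> h \<partial>Pi\<^sub>M (I \<union> J) M) = (\<integral>h. \<phi> h \<partial>Pi\<^sub>M I M) * (\<integral>h. \<psi> h \<partial>Pi\<^sub>M J M)"
proof -
  have "\<phi> (merge I J (x, y)) = \<phi> x" for x y
    by (rule \<phi>) (simp add: merge_def)
  moreover have "\<psi> (merge I J (x, y)) = \<psi> y" for x y
    by (rule \<psi>) (use IJ in \<open>auto simp: merge_def\<close>)
  ultimately show ?thesis
    by (subst product_integral_fold[OF IJ int]) simp
qed

lemma finite_measure_imp_product_sigma_finite:
  "finite_measure \<nu> \<Longrightarrow> product_sigma_finite (\<lambda>_. \<nu>)"
  by (simp add: product_sigma_finite_def finite_measure_def)

lemma finite_measure_PiM:
  assumes "finite_measure \<nu>" "finite I"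
  shows "finite_measure (Pi\<^sub>M I (\<lambda>_. \<nu>))"
    and "measure (Pi\<^sub>M I (\<lambda>_. \<nu>)) (space (Pi\<^sub>M I (\<lambda>_. \<nu>))) = measure \<nu> (space \<nu>) ^ card I"
proof -
  interpret \<nu>: finite_measure \<nu> by fact
  interpret product_sigma_finite "\<lambda>_. \<nu>"
    using assms(1) by (rule finite_measure_imp_product_sigma_finite)
  have eq: "emeasure (Pi\<^sub>M I (\<lambda>_. \<nu>)) (space (Pi\<^sub>M I (\<lambda>_. \<nu>))) = ennreal (measure \<nu> (space \<nu>) ^ card I)"
    unfolding space_PiM using assms(2)
    by (subst emeasure_PiM) (auto simp: \<nu>.emeasure_eq_measure ennreal_power)
  show "finite_measure (Pi\<^sub>M I (\<lambda>_. \<nu>))"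
    by (rule finite_measureI) (simp add: eq)
  show "measure (Pi\<^sub>M I (\<lambda>_. \<nu>)) (space (Pi\<^sub>M I (\<lambda>_. \<nu>))) = measure \<nu> (space \<nu>) ^ card I"
    by (simp add: measure_def eq)
qed

text \<open>Given the pivot coordinate \<open>h i = y\<close>, the remaining coordinates range
  independently over \<open>ball y R\<close>. This converts the hypothesis on the measures into the
  mass of nearly diagonal configurations.\<close>

lemma measure_PiM_near:
  fixes \<nu> :: "'h::{metric_space, second_countable_topology} measure"
  assumes \<nu>: "finite_measure \<nu>" and sets [measurable_cong]: "sets \<nu> = sets borel"
    and I: "finite I" "i \<notin> I"
  shows "{h \<in> space (Pi\<^sub>M (insert i I) (\<lambda>_. \<nu>)). \<forall>j\<in>I. dist (h i) (h j) < R} \<in> sets (Pi\<^sub>M (insert i I) (\<lambda>_. \<nu>))"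
      (is "?D \<in> sets ?P")
    and "measure (Pi\<^sub>M (insert i I) (\<lambda>_. \<nu>))
           {h \<in> space (Pi\<^sub>M (insert i I) (\<lambda>_. \<nu>)). \<forall>j\<in>I. dist (h i) (h j) < R}
         = (\<integral>y. measure \<nu> (ball y R) ^ card I \<partial>\<nu>)"
proof -
  interpret \<nu>: finite_measure \<nu> by fact
  interpret product_sigma_finite "\<lambda>_. \<nu>"
    using \<nu> by (rule finite_measure_imp_product_sigma_finite)
  have space: "space \<nu> = UNIV" using sets_eq_imp_space_eq[OF sets] by simp
  show D [measurable]: "?D \<in> sets ?P"
  proof (rule sets.sets_Collect_finite_All[OF _ I(1)])
    fix j assume "j \<in> I"
    then have [measurable]: "(\<lambda>h. h i) \<in> ?P \<rightarrow>\<^sub>M borel" "(\<lambda>h. h j) \<in> ?P \<rightarrow>\<^sub>M borel"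
      using measurable_component_singleton[of _ "insert i I" "\<lambda>_. \<nu>"] sets
      by (auto cong: measurable_cong_sets)
    show "{h \<in> space ?P. dist (h i) (h j) < R} \<in> sets ?P" by measurable
  qed
  \<comment> \<open>The mass of a ball is measurable in its centre because it is the measure of a
    slice of an open set; second countability makes this set measurable for the product
    sigma-algebra.\<close>
  have "open {p::'h \<times> 'h. dist (fst p) (snd p) < R}"
    by (intro open_Collect_less continuous_intros)
  then have "{p::'h \<times> 'h. dist (fst p) (snd p) < R} \<in> sets (borel \<Otimes>\<^sub>M borel)"
    unfolding borel_prod by (rule borel_open)
  then have "{p::'h \<times> 'h. dist (fst p) (snd p) < R} \<in> sets (borel \<Otimes>\<^sub>M \<nu>)"
    by (simp only: sets_pair_measure_cong[OF refl sets])
  from \<nu>.measurable_emeasure_Pair[OF this]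
  have "(\<lambda>y. emeasure \<nu> (ball y R)) \<in> borel_measurable borel"
    by (simp add: vimage_def ball_def)
  then have [measurable]: "(\<lambda>y. measure \<nu> (ball y R)) \<in> borel_measurable \<nu>"
    unfolding measure_def by measurable
  have "emeasure ?P ?D = (\<integral>\<^sup>+ h. indicator ?D h \<partial>?P)" using D by simp
  also have "\<dots> = (\<integral>\<^sup>+ y. (\<integral>\<^sup>+ x. indicator ?D (x(i := y)) \<partial>(Pi\<^sub>M I (\<lambda>_. \<nu>))) \<partial>\<nu>)"
    using D by (intro product_nn_integral_insert_rev[OF I]) auto
  also have "\<dots> = (\<integral>\<^sup>+ y. ennreal (measure \<nu> (ball y R) ^ card I) \<partial>\<nu>)"
  proof (rule nn_integral_cong)
    fix y
    have "(\<integral>\<^sup>+ x. indicator ?D (x(i := y)) \<partial>(Pi\<^sub>M I (\<lambda>_. \<nu>)))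
        = (\<integral>\<^sup>+ x. indicator (Pi\<^sub>E I (\<lambda>_. ball y R)) x \<partial>(Pi\<^sub>M I (\<lambda>_. \<nu>)))"
    proof (rule nn_integral_cong)
      fix x assume x: "x \<in> space (Pi\<^sub>M I (\<lambda>_. \<nu>))"
      then have "x(i := y) \<in> space ?P" by (auto simp: space_PiM space PiE_iff extensional_def)
      moreover have "(\<forall>j\<in>I. dist ((x(i := y)) i) ((x(i := y)) j) < R) \<longleftrightarrow> (\<forall>j\<in>I. dist y (x j) < R)"
        using I(2) by auto
      ultimately show "(indicator ?D (x(i := y)) :: ennreal) = indicator (Pi\<^sub>E I (\<lambda>_. ball y R)) x"
        using x by (auto simp: indicator_def space_PiM PiE_iff)
    qed
    also have "\<dots> = emeasure (Pi\<^sub>M I (\<lambda>_. \<nu>)) (Pi\<^sub>E I (\<lambda>_. ball y R))"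
      using I(1) by (intro nn_integral_indicator sets_PiM_I_finite) (auto simp: sets)
    also have "\<dots> = ennreal (measure \<nu> (ball y R) ^ card I)"
      using I(1) by (subst emeasure_PiM) (auto simp: sets \<nu>.emeasure_eq_measure ennreal_power)
    finally show "(\<integral>\<^sup>+ x. indicator ?D (x(i := y)) \<partial>(Pi\<^sub>M I (\<lambda>_. \<nu>))) = ennreal (measure \<nu> (ball y R) ^ card I)" .
  qed
  also have "\<dots> = ennreal (\<integral>y. measure \<nu> (ball y R) ^ card I \<partial>\<nu>)"
  proof (rule nn_integral_eq_integral)
    have "norm (measure \<nu> (ball y R) ^ card I) \<le> measure \<nu> (space \<nu>) ^ card I" for y
      by (simp add: power_mono \<nu>.bounded_measure)
    then show "integrable \<nu> (\<lambda>y. measure \<nu> (ball y R) ^ card I)"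
      by (intro \<nu>.integrable_const_bound[where B = "measure \<nu> (space \<nu>) ^ card I"]) auto
  qed simp
  finally show "measure ?P ?D = (\<integral>y. measure \<nu> (ball y R) ^ card I \<partial>\<nu>)"
    by (simp add: measure_def)
qed

section \<open>Moments and cumulants of the averages as integrals over the group\<close>

context mixing_action
begin

lemma cumulant_correlation_bounded:
  assumes "g \<in> borel_measurable M" "\<And>x. \<bar>g x\<bar> \<le> b" "b \<ge> 1"
  shows "\<exists>G\<ge>0. \<forall>S h. finite S \<longrightarrow> card S \<le> n \<longrightarrow> \<bar>cumulant (correlation g h) S\<bar> \<le> G"
proof -
  have "b ^ n \<ge> 0" using assms(3) by simp
  from cumulant_bounded[OF this, of n] obtain G where G: "G \<ge> 0"
    "\<And>S m. finite S \<Longrightarrow> card S \<le> n \<Longrightarrow> \<forall>J\<subseteq>S. \<bar>m J\<bar> \<le> b ^ n \<Longrightarrow> \<bar>cumulant m S\<bar> \<le> G"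
    by blast
  have "\<bar>cumulant (correlation g h) S\<bar> \<le> G" if S: "finite S" "card S \<le> n" for S h
  proof (rule G(2)[OF S], intro allI impI)
    fix J assume "J \<subseteq> S"
    then have "finite J" "card J \<le> n" using S card_mono[of S J] by (auto intro: finite_subset)
    then show "\<bar>correlation g h J\<bar> \<le> b ^ n"
      by (rule correlation_bounded[OF assms])
  qed
  then show ?thesis using G(1) by blast
qed

text \<open>Formulated for arbitrary measurable \<open>\<eta>\<close> and \<open>\<xi>\<close>, so
  that it covers sections in the group variable, both orders of a product, and coordinates of a
  power of the group.\<close>

lemma measurable_fun_act_joint:
  assumes "g \<in> borel_measurable M" "\<eta> \<in> P \<rightarrow>\<^sub>M borel" "\<xi> \<in> P \<rightarrow>\<^sub>M M"
  shows "(\<lambda>p. fun_act a (\<eta> p) g (\<xi> p)) \<in> borel_measurable P"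
proof -
  have "(uminus :: 'h \<Rightarrow> 'h) \<in> borel \<rightarrow>\<^sub>M borel"
    using H by (intro borel_measurable_continuous_onI) (simp add: lcsc_group_left_inv_metric_def)
  then have "(\<lambda>p. (- \<eta> p, \<xi> p)) \<in> P \<rightarrow>\<^sub>M borel \<Otimes>\<^sub>M M"
    using measurable_compose[OF assms(2)] assms(3) by (intro measurable_Pair) auto
  moreover have "(\<lambda>p. a (fst p) (snd p)) \<in> borel \<Otimes>\<^sub>M M \<rightarrow>\<^sub>M M"
    using act by (simp add: mp_action_def)
  ultimately have "(\<lambda>p. a (- \<eta> p) (\<xi> p)) \<in> P \<rightarrow>\<^sub>M M"
    using measurable_compose[of "\<lambda>p. (- \<eta> p, \<xi> p)" P _ "\<lambda>p. a (fst p) (snd p)"] by simp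
  then show ?thesis
    unfolding fun_act_def using assms(1) by (rule measurable_compose)
qed

context
  fixes \<nu> :: "'h measure"
  assumes sets_\<nu>: "sets \<nu> = sets borel" and finite_\<nu>: "finite_measure \<nu>"
begin

lemma measurable_PiM_coordinate:
  assumes "i \<in> S"
  shows "(\<lambda>h. h i) \<in> Pi\<^sub>M S (\<lambda>_. \<nu>) \<rightarrow>\<^sub>M borel"
  using measurable_component_singleton[OF assms, of "\<lambda>_. \<nu>"] sets_\<nu> by (simp cong: measurable_cong_sets)

lemma measurable_meas_conv:
  assumes "g \<in> borel_measurable M"
  shows "meas_conv a \<nu> g \<in> borel_measurable M"
proof -
  interpret \<nu>: finite_measure \<nu> by (rule finite_\<nu>)
  have "(\<lambda>p. fun_act a (snd p) g (fst p)) \<in> borel_measurable (M \<Otimes>\<^sub>M \<nu>)"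
    by (rule measurable_fun_act_joint[OF assms])
       (use measurable_snd[of M \<nu>] sets_\<nu> in \<open>simp_all cong: measurable_cong_sets\<close>)
  then show ?thesis
    unfolding meas_conv_def
    by (intro \<nu>.borel_measurable_lebesgue_integral) (simp add: case_prod_beta)
qed

text \<open>The exceptional null set in \<open>x\<close> depends on \<open>h\<close>; Fubini
  exchanges the two quantifiers, after which the integrands agree for almost all
  \<open>x\<close>.\<close>

lemma AE_meas_conv_cong:
  assumes "AE x in M. f x = g x" "f \<in> borel_measurable M" "g \<in> borel_measurable M"
  shows "AE x in M. meas_conv a \<nu> f x = meas_conv a \<nu> g x"
proof -
  interpret \<nu>: finite_measure \<nu> by (rule finite_\<nu>)
  interpret pair_sigma_finite \<nu> M by standard
  have fst: "fst \<in> \<nu> \<Otimes>\<^sub>M M \<rightarrow>\<^sub>M borel"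
    using measurable_fst[of \<nu> M] sets_\<nu> by (simp cong: measurable_cong_sets)
  have [measurable]: "(\<lambda>p. fun_act a (fst p) f (snd p)) \<in> borel_measurable (\<nu> \<Otimes>\<^sub>M M)"
      "(\<lambda>p. fun_act a (fst p) g (snd p)) \<in> borel_measurable (\<nu> \<Otimes>\<^sub>M M)"
    using assms fst by (auto intro!: measurable_fun_act_joint)
  have "AE h in \<nu>. AE x in M. fun_act a h f x = fun_act a h g x"
    unfolding fun_act_def by (intro AE_I2 AE_fun_act[OF assms(1)])
  then have "AE x in M. AE h in \<nu>. fun_act a h f x = fun_act a h g x"
    by (subst AE_commute[symmetric]) measurable
  then show ?thesis
  proof (rule AE_mp, intro AE_I2 impI)
    fix x assume x: "x \<in> space M" and ae: "AE h in \<nu>. fun_act a h f x = fun_act a h g x"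
    have m: "(\<lambda>h. fun_act a h k x) \<in> borel_measurable \<nu>" if "k \<in> borel_measurable M" for k
      using that x sets_\<nu> by (intro measurable_fun_act_joint) (auto cong: measurable_cong_sets)
    show "meas_conv a \<nu> f x = meas_conv a \<nu> g x"
      unfolding meas_conv_def using ae assms by (intro integral_cong_AE m)
  qed
qed

context
  fixes g :: "'x \<Rightarrow> real" and b :: real
  assumes g_meas: "g \<in> borel_measurable M" and g_bounded: "\<And>x. \<bar>g x\<bar> \<le> b" and b_ge_1: "b \<ge> 1"
begin

lemma meas_conv_bounded:
  assumes "x \<in> space M"
  shows "\<bar>meas_conv a \<nu> g x\<bar> \<le> b * total_mass \<nu>"
proof -
  interpret \<nu>: finite_measure \<nu> by (rule finite_\<nu>)
  have "(\<lambda>h. fun_act a h g x) \<in> borel_measurable \<nu>"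
    using assms sets_\<nu> g_meas by (intro measurable_fun_act_joint) (auto cong: measurable_cong_sets)
  moreover have "\<bar>fun_act a h g x\<bar> \<le> b" for h using g_bounded by (simp add: fun_act_def)
  ultimately show ?thesis
    unfolding meas_conv_def total_mass_def by (intro \<nu>.abs_integral_le_const) auto
qed

lemma integrable_meas_conv_power: "integrable M (\<lambda>x. meas_conv a \<nu> g x ^ k)"
proof (rule integrable_const_bound)
  show "AE x in M. norm (meas_conv a \<nu> g x ^ k) \<le> (b * total_mass \<nu>) ^ k"
    using meas_conv_bounded by (intro AE_I2) (simp add: power_abs power_mono)
qed (use measurable_meas_conv[OF g_meas] in simp)

lemma measurable_correlation_integrand:
  assumes "J \<subseteq> S"
  shows "(\<lambda>p. \<Prod>i\<in>J. fun_act a (fst p i) g (snd p)) \<in> borel_measurable (Pi\<^sub>M S (\<lambda>_. \<nu>) \<Otimes>\<^sub>M M)"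
proof (intro borel_measurable_prod measurable_fun_act_joint[OF g_meas])
  fix i assume "i \<in> J"
  then show "(\<lambda>p. fst p i) \<in> Pi\<^sub>M S (\<lambda>_. \<nu>) \<Otimes>\<^sub>M M \<rightarrow>\<^sub>M borel"
    using measurable_compose[OF measurable_fst measurable_PiM_coordinate, of i S M] assms by auto
qed simp

lemma measurable_correlation:
  assumes "J \<subseteq> S"
  shows "(\<lambda>h. correlation g h J) \<in> borel_measurable (Pi\<^sub>M S (\<lambda>_. \<nu>))"
  unfolding correlation_def
  using measurable_correlation_integrand[OF assms]
  by (intro borel_measurable_lebesgue_integral) (simp add: case_prod_beta)

lemma measurable_cumulant_correlation:
  assumes "finite J" "J \<subseteq> S"
  shows "(\<lambda>h. cumulant (correlation g h) J) \<in> borel_measurable (Pi\<^sub>M S (\<lambda>_. \<nu>))"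
  using assms
proof (induction J rule: finite_psubset_induct)
  case (psubset J)
  have "(\<lambda>h. correlation g h J - (\<Sum>K\<in>{K. K \<subset> J \<and> Min J \<in> K}. cumulant (correlation g h) K * correlation g h (J - K)))
      \<in> borel_measurable (Pi\<^sub>M S (\<lambda>_. \<nu>))"
    using psubset.prems psubset.IH
    by (intro borel_measurable_diff borel_measurable_sum borel_measurable_times measurable_correlation) auto
  then show ?case using psubset.hyps by (simp add: cumulant.simps[of _ J])
qed

text \<open>Fubini exchanges \<open>M\<close> with the power of \<open>\<nu>\<close>; for fixed
  \<open>x\<close> the inner integral is a product of identical one-variable integrals.\<close>

lemma integral_correlation:
  assumes S: "finite S"
  shows "(\<integral>h. correlation g h S \<partial>Pi\<^sub>M S (\<lambda>_. \<nu>)) = (\<integral>x. meas_conv a \<nu> g x ^ card S \<partial>M)"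
proof -
  interpret \<nu>: finite_measure \<nu> by (rule finite_\<nu>)
  interpret product_sigma_finite "\<lambda>_. \<nu>"
    using finite_\<nu> by (rule finite_measure_imp_product_sigma_finite)
  interpret P: finite_measure "Pi\<^sub>M S (\<lambda>_. \<nu>)" by (rule finite_measure_PiM[OF finite_\<nu> S])
  interpret PM: pair_sigma_finite "Pi\<^sub>M S (\<lambda>_. \<nu>)" M by standard
  interpret PM: finite_measure "Pi\<^sub>M S (\<lambda>_. \<nu>) \<Otimes>\<^sub>M M"
    by (rule finite_measure_pair_measure) (rule finite_measure_axioms P.finite_measure_axioms)+
  have bound: "\<bar>\<Prod>i\<in>S. fun_act a (h i) g x\<bar> \<le> b ^ card S" for h x
  proof -
    have "\<bar>\<Prod>i\<in>S. fun_act a (h i) g x\<bar> \<le> (\<Prod>i\<in>S. b)"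
      unfolding abs_prod using g_bounded by (intro prod_mono) (auto simp: fun_act_def)
    then show ?thesis by simp
  qed
  have "integrable (Pi\<^sub>M S (\<lambda>_. \<nu>) \<Otimes>\<^sub>M M) (\<lambda>p. \<Prod>i\<in>S. fun_act a (fst p i) g (snd p))"
    by (rule PM.integrable_const_bound[where B = "b ^ card S"])
       (use bound measurable_correlation_integrand[of S S] in auto)
  then have "integrable (Pi\<^sub>M S (\<lambda>_. \<nu>) \<Otimes>\<^sub>M M) (\<lambda>(h, x). \<Prod>i\<in>S. fun_act a (h i) g x)"
    by (simp add: case_prod_beta')
  from PM.Fubini_integral[OF this]
  have "(\<integral>h. correlation g h S \<partial>Pi\<^sub>M S (\<lambda>_. \<nu>))
      = (\<integral>x. (\<integral>h. (\<Prod>i\<in>S. fun_act a (h i) g x) \<partial>Pi\<^sub>M S (\<lambda>_. \<nu>)) \<partial>M)"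
    unfolding correlation_def by simp
  also have "\<dots> = (\<integral>x. meas_conv a \<nu> g x ^ card S \<partial>M)"
  proof (rule Bochner_Integration.integral_cong[OF refl])
    fix x assume x: "x \<in> space M"
    have "integrable \<nu> (\<lambda>h. fun_act a h g x)"
    proof (rule \<nu>.integrable_const_bound[where B = b])
      show "(\<lambda>h. fun_act a h g x) \<in> borel_measurable \<nu>"
        using x sets_\<nu> g_meas by (intro measurable_fun_act_joint) (auto cong: measurable_cong_sets)
    qed (use g_bounded in \<open>simp add: fun_act_def\<close>)
    then show "(\<integral>h. (\<Prod>i\<in>S. fun_act a (h i) g x) \<partial>Pi\<^sub>M S (\<lambda>_. \<nu>)) = meas_conv a \<nu> g x ^ card S"
      using product_integral_prod[OF S, of "\<lambda>_ h. fun_act a h g x"] by (simp add: meas_conv_def)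
  qed
  finally show ?thesis .
qed

text \<open>Integration commutes with the cumulant recursion, since the two factors of each term
  depend on the disjoint coordinate sets \<open>J\<close> and \<open>S - J\<close>.\<close>

lemma integral_cumulant_correlation:
  assumes "finite S"
  shows "(\<integral>h. cumulant (correlation g h) S \<partial>Pi\<^sub>M S (\<lambda>_. \<nu>))
       = cumulant (\<lambda>J. \<integral>x. meas_conv a \<nu> g x ^ card J \<partial>M) S"
  using assms
proof (induction S rule: finite_psubset_induct)
  case (psubset S)
  interpret product_sigma_finite "\<lambda>_. \<nu>"
    using finite_\<nu> by (rule finite_measure_imp_product_sigma_finite)
  interpret P: finite_measure "Pi\<^sub>M S (\<lambda>_. \<nu>)" by (rule finite_measure_PiM[OF finite_\<nu> psubset.hyps])
  let ?I = "{J. J \<subset> S \<and> Min S \<in> J}"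
  have corr_bound: "\<bar>correlation g h J\<bar> \<le> b ^ card S" if "J \<subseteq> S" for h J
    using that psubset.hyps
    by (intro correlation_bounded[OF g_meas g_bounded b_ge_1]) (auto intro: finite_subset card_mono)
  have int: "integrable (Pi\<^sub>M S (\<lambda>_. \<nu>)) (\<lambda>h. correlation g h S)"
    using measurable_correlation[of S S] corr_bound[of S]
    by (intro P.integrable_const_bound[where B = "b ^ card S"]) auto
  obtain G where G: "G \<ge> 0"
    "\<And>J h. finite J \<Longrightarrow> card J \<le> card S \<Longrightarrow> \<bar>cumulant (correlation g h) J\<bar> \<le> G"
    using cumulant_correlation_bounded[OF g_meas g_bounded b_ge_1, of "card S"] by blast
  have int2: "integrable (Pi\<^sub>M S (\<lambda>_. \<nu>)) (\<lambda>h. cumulant (correlation g h) J * correlation g h (S - J))"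
    if "J \<in> ?I" for J
  proof (rule P.integrable_const_bound[where B = "G * b ^ card S"])
    have J: "finite J" "card J \<le> card S" "J \<subseteq> S"
      using that psubset.hyps by (auto intro: finite_subset card_mono)
    show "(\<lambda>h. cumulant (correlation g h) J * correlation g h (S - J)) \<in> borel_measurable (Pi\<^sub>M S (\<lambda>_. \<nu>))"
      using J by (intro borel_measurable_times measurable_cumulant_correlation measurable_correlation) auto
    show "AE h in Pi\<^sub>M S (\<lambda>_. \<nu>). norm (cumulant (correlation g h) J * correlation g h (S - J)) \<le> G * b ^ card S"
      using G(2)[OF J(1,2)] corr_bound[of "S - J"] G(1)
      by (intro AE_I2) (auto simp: abs_mult intro!: mult_mono)
  qed
  have "(\<integral>h. cumulant (correlation g h) S \<partial>Pi\<^sub>M S (\<lambda>_. \<nu>))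
      = (\<integral>h. correlation g h S - (\<Sum>J\<in>?I. cumulant (correlation g h) J * correlation g h (S - J)) \<partial>Pi\<^sub>M S (\<lambda>_. \<nu>))"
    using psubset.hyps by (simp add: cumulant.simps[of _ S])
  also have "\<dots> = (\<integral>h. correlation g h S \<partial>Pi\<^sub>M S (\<lambda>_. \<nu>))
      - (\<Sum>J\<in>?I. (\<integral>h. cumulant (correlation g h) J * correlation g h (S - J) \<partial>Pi\<^sub>M S (\<lambda>_. \<nu>)))"
    using int int2
    by (subst Bochner_Integration.integral_diff)
       (auto simp: Bochner_Integration.integral_sum intro!: Bochner_Integration.integrable_sum)
  also have "(\<Sum>J\<in>?I. (\<integral>h. cumulant (correlation g h) J * correlation g h (S - J) \<partial>Pi\<^sub>M S (\<lambda>_. \<nu>)))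
      = (\<Sum>J\<in>?I. cumulant (\<lambda>J. \<integral>x. meas_conv a \<nu> g x ^ card J \<partial>M) J * (\<integral>x. meas_conv a \<nu> g x ^ card (S - J) \<partial>M))"
  proof (rule sum.cong[OF refl])
    fix J assume J: "J \<in> ?I"
    then have JS: "J \<union> (S - J) = S" "finite J" "finite (S - J)"
      using psubset.hyps by (auto intro: finite_subset)
    have local: "correlation g h K = correlation g h' K" if "\<And>i. i \<in> K \<Longrightarrow> h i = h' i" for h h' K
      unfolding correlation_def using that by (simp cong: prod.cong)
    have "(\<integral>h. cumulant (correlation g h) J * correlation g h (S - J) \<partial>Pi\<^sub>M (J \<union> (S - J)) (\<lambda>_. \<nu>))
        = (\<integral>h. cumulant (correlation g h) J \<partial>Pi\<^sub>M J (\<lambda>_. \<nu>)) * (\<integral>h. correlation g h (S - J) \<partial>Pi\<^sub>M (S - J) (\<lambda>_. \<nu>))"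
    proof (rule product_integral_mult_disjoint)
      show "cumulant (correlation g h) J = cumulant (correlation g h') J" if "\<And>i. i \<in> J \<Longrightarrow> h i = h' i" for h h'
        using that by (intro cumulant_cong local) auto
      show "correlation g h (S - J) = correlation g h' (S - J)" if "\<And>i. i \<in> S - J \<Longrightarrow> h i = h' i" for h h'
        using that by (rule local)
    qed (use JS int2[OF J] in auto)
    then show "(\<integral>h. cumulant (correlation g h) J * correlation g h (S - J) \<partial>Pi\<^sub>M S (\<lambda>_. \<nu>))
        = cumulant (\<lambda>J. \<integral>x. meas_conv a \<nu> g x ^ card J \<partial>M) J * (\<integral>x. meas_conv a \<nu> g x ^ card (S - J) \<partial>M)"
      using psubset.IH[of J] J JS by (simp add: integral_correlation)
  qed
  finally show ?case
    using psubset.hyps by (simp add: cumulant.simps[of _ S] integral_correlation)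
qed

end
end
end

section \<open>Decay of the cumulants of order at least 3\<close>

text \<open>The cumulant integral is split by whether all points are close to a fixed pivot
  \<open>h i\<close>. Near the pivot a bounded integrand meets a set of vanishing measure; elsewhere
  the pointwise decay outweighs the total mass.\<close>

lemma (in mixing_action) cumulant_meas_conv_tendsto_0:
  fixes \<nu> :: "nat \<Rightarrow> 'h measure"
  assumes nu_borel: "\<And>T. sets (\<nu> T) = sets borel"
    and nu_fin: "\<And>T. finite_measure (\<nu> T)"
    and nu_mass: "filterlim (\<lambda>T. total_mass (\<nu> T)) at_top sequentially"
    and nu_conc: "\<And>(r::nat) (c::real). r \<ge> 3 \<Longrightarrow> c > 0 \<Longrightarrow>
        (\<lambda>T. \<integral>h. (measure (\<nu> T) (ball h (c * ln (total_mass (\<nu> T))))) ^ (r - 1) \<partial>(\<nu> T))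
          \<longlonglongrightarrow> 0"
    and fA: "f \<in> A" and fg: "AE x in M. f x = g x"
    and g: "g \<in> borel_measurable M" "\<And>x. \<bar>g x\<bar> \<le> b" "b \<ge> 1"
    and S: "finite S" "card S \<ge> 3"
  shows "(\<lambda>T. cumulant (\<lambda>J. \<integral>x. meas_conv a (\<nu> T) g x ^ card J \<partial>M) S) \<longlonglongrightarrow> 0"
proof -
  define r where "r = card S"
  have S_ne: "S \<noteq> {}" and r1: "r \<ge> 1" using S by (auto simp: r_def)
  then obtain i where i: "i \<in> S" by blast
  define I where "I = S - {i}"
  have I: "insert i I = S" "finite I" "i \<notin> I" "card I = r - 1"
    using i S by (auto simp: I_def r_def)
  have corr: "correlation f h J = correlation g h J" if "finite J" for h J
    by (rule correlation_cong_AE[OF fg algebra_measurable[OF fA] g(1) that])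
  have "b ^ r \<ge> 1" using g(3) by simp
  moreover have "\<bar>correlation f h J\<bar> \<le> b ^ r" if "finite J" "card J \<le> r" for h J
    unfolding corr[OF that(1)] by (rule correlation_bounded[OF g that])
  ultimately obtain c G where c: "c > 0" and G: "G \<ge> 0" and
    spread: "\<And>S h L. card S = r \<Longrightarrow> L > 0 \<Longrightarrow> \<exists>i\<in>S. \<exists>j\<in>S. c * L \<le> dist (h i) (h j) \<Longrightarrow>
       \<bar>cumulant (correlation f h) S\<bar> \<le> G * exp (- (real r + 1) * L)"
    using cumulant_correlation_spread[OF fA r1, of "b ^ r"] by blast
  obtain G1 where G1: "G1 \<ge> 0" "\<And>h. \<bar>cumulant (correlation g h) S\<bar> \<le> G1"
    using cumulant_correlation_bounded[OF g, of r] S by (auto simp: r_def)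
  define K where "K T = (\<integral>h. measure (\<nu> T) (ball h (c * ln (total_mass (\<nu> T)))) ^ (r - 1) \<partial>\<nu> T)" for T
  \<comment> \<open>The concentration hypothesis holds for every positive constant, in particular
    for the \<open>c\<close> dictated by mixing.\<close>
  have K0: "K \<longlonglongrightarrow> 0" using nu_conc[of r c] S c by (simp add: K_def[abs_def] r_def)
  have bound: "\<bar>cumulant (\<lambda>J. \<integral>x. meas_conv a (\<nu> T) g x ^ card J \<partial>M) S\<bar>
      \<le> G1 * K T + G * inverse (total_mass (\<nu> T))" if T: "total_mass (\<nu> T) > 1" for T
  proof -
    define m where "m = total_mass (\<nu> T)"
    have L: "ln m > 0" using T by (simp add: m_def)
    let ?P = "Pi\<^sub>M S (\<lambda>_. \<nu> T)"
    interpret P: finite_measure ?P by (rule finite_measure_PiM[OF nu_fin S(1)])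
    define D where "D = {h \<in> space ?P. \<forall>j\<in>I. dist (h i) (h j) < c * ln m}"
    have D: "D \<in> sets ?P" "measure ?P D = K T"
      using measure_PiM_near[OF nu_fin nu_borel I(2,3), of T "c * ln m"] I
      by (simp_all add: D_def K_def m_def)
    have cum_meas: "(\<lambda>h. cumulant (correlation g h) S) \<in> borel_measurable ?P"
      by (rule measurable_cumulant_correlation[OF nu_borel nu_fin g S(1) order_refl])
    have int: "integrable ?P (\<lambda>h. cumulant (correlation g h) S)"
      by (rule P.integrable_const_bound[OF _ cum_meas, where B = G1]) (use G1 in simp)
    have pointwise: "\<bar>cumulant (correlation g h) S\<bar> \<le> G1 * indicator D h + G * exp (- (real r + 1) * ln m)"
      if h: "h \<in> space ?P" for h
    proof (cases "h \<in> D")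
      case True
      then show ?thesis using G1(2)[of h] G by (simp add: add_increasing2)
    next
      case False
      then obtain j where "j \<in> I" "c * ln m \<le> dist (h i) (h j)"
        using h by (auto simp: D_def not_less)
      \<comment> \<open>Mixing is available for \<open>f\<close>, which lies in \<open>A\<close>;
        the estimate passes to \<open>g\<close> because their correlations coincide.\<close>
      then have "\<bar>cumulant (correlation f h) S\<bar> \<le> G * exp (- (real r + 1) * ln m)"
        using I(1) i L by (intro spread) (auto simp: r_def)
      moreover have "cumulant (correlation f h) S = cumulant (correlation g h) S"
        using S(1) by (intro cumulant_cong corr) (auto intro: finite_subset)
      ultimately show ?thesis using False by simp
    qed
    have "\<bar>\<integral>h. cumulant (correlation g h) S \<partial>?P\<bar> \<le> (\<integral>h. \<bar>cumulant (correlation g h) S\<bar> \<partial>?P)"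
      using integral_norm_bound[of ?P "\<lambda>h. cumulant (correlation g h) S"] by simp
    also have "\<dots> \<le> (\<integral>h. G1 * indicator D h + G * exp (- (real r + 1) * ln m) \<partial>?P)"
      using int D(1) pointwise
      by (intro integral_mono Bochner_Integration.integrable_add integrable_mult_right)
         (auto simp: P.emeasure_finite less_top[symmetric])
    also have "\<dots> = G1 * K T + G * exp (- (real r + 1) * ln m) * m ^ r"
      using D finite_measure_PiM(2)[OF nu_fin S(1), of T] sets.sets_into_space[OF D(1)]
      by (subst Bochner_Integration.integral_add)
         (auto simp: P.emeasure_finite less_top[symmetric] m_def total_mass_def r_def Int_absorb2)
    \<comment> \<open>The extra 1 in the rate \<open>real r + 1\<close> is what remains after the
      factor \<open>m ^ r\<close> from the total mass.\<close>
    also have "exp (- (real r + 1) * ln m) * m ^ r = inverse m"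
    proof -
      have "exp (- (real r + 1) * ln m) = inverse (exp (real (Suc r) * ln m))"
        by (simp add: exp_minus[symmetric] algebra_simps)
      also have "\<dots> = inverse (m ^ Suc r)"
        using T by (subst exp_of_nat_mult) (simp add: m_def)
      finally show ?thesis using T by (simp add: m_def field_simps)
    qed
    then have "G * exp (- (real r + 1) * ln m) * m ^ r = G * inverse m" by (simp only: mult.assoc)
    finally show ?thesis
      unfolding integral_cumulant_correlation[OF nu_borel nu_fin g S(1)] m_def .
  qed
  have "eventually (\<lambda>T. total_mass (\<nu> T) > 1) sequentially"
    using nu_mass by (simp add: filterlim_at_top_dense)
  then have ev: "eventually (\<lambda>T. norm (cumulant (\<lambda>J. \<integral>x. meas_conv a (\<nu> T) g x ^ card J \<partial>M) S)
      \<le> G1 * K T + G * inverse (total_mass (\<nu> T))) sequentially"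
    by eventually_elim (simp add: bound)
  have "(\<lambda>T. G1 * K T + G * inverse (total_mass (\<nu> T))) \<longlonglongrightarrow> G1 * 0 + G * 0"
    by (intro tendsto_intros K0 tendsto_inverse_0_at_top nu_mass)
  then have "(\<lambda>T. G1 * K T + G * inverse (total_mass (\<nu> T))) \<longlonglongrightarrow> 0" by simp
  from Lim_null_comparison[OF ev this] show ?thesis .
qed

section \<open>Convergence in distribution of the averages\<close>

theorem theorem1p5:
  fixes a :: "'h::{group_add, metric_space, second_countable_topology} \<Rightarrow> 'x \<Rightarrow> 'x"
    and M :: "'x measure"
    and A :: "('x \<Rightarrow> real) set"
    and N :: "nat \<Rightarrow> ('x \<Rightarrow> real) \<Rightarrow> real"
    and \<nu> :: "nat \<Rightarrow> 'h measure"
    and f :: "'x \<Rightarrow> real"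
    and \<sigma>f :: real
  assumes H: "lcsc_group_left_inv_metric TYPE('h)"
    and P: "prob_space M"
    and act: "mp_action a M"
    and alg: "inv_subalgebra a M A"
    and semi: "seminorm_family a M A N"
    and mix: "exp_mixing_all_orders a M A N"
    and nu_borel: "\<And>T. sets (\<nu> T) = sets borel"
    and nu_fin: "\<And>T. finite_measure (\<nu> T)"
    and nu_mass: "filterlim (\<lambda>T. total_mass (\<nu> T)) at_top sequentially"
    and nu_conc: "\<And>(r::nat) (c::real). r \<ge> 3 \<Longrightarrow> c > 0 \<Longrightarrow>
        (\<lambda>T. \<integral>h. (measure (\<nu> T) (ball h (c * ln (total_mass (\<nu> T))))) ^ (r - 1) \<partial>(\<nu> T))
          \<longlonglongrightarrow> 0"
    and fA: "f \<in> A"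
    and f_mean: "(\<integral>x. f x \<partial>M) = 0"
    and lim: "(\<lambda>T. sqrt (\<integral>x. (meas_conv a (\<nu> T) f x)\<^sup>2 \<partial>M)) \<longlonglongrightarrow> \<sigma>f"
  shows "weak_conv_m (\<lambda>T. distr M borel (meas_conv a (\<nu> T) f)) (centered_gaussian \<sigma>f)"
proof -
  interpret prob_space M by fact
  interpret mixing_action M a A N
    by (intro mixing_action.intro mixing_action_axioms.intro) fact+
  have f_meas: "f \<in> borel_measurable M" by (rule algebra_measurable[OF fA])
  obtain B where B: "AE x in M. \<bar>f x\<bar> \<le> B" using alg fA by (auto simp: inv_subalgebra_def)
  define b where "b = max 1 B"
  \<comment> \<open>\<open>f\<close> is only essentially bounded; the truncation \<open>g\<close> need not lie in \<open>A\<close>, but has the same correlations.\<close>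
  define g where "g x = max (- b) (min b (f x))" for x
  have g: "g \<in> borel_measurable M" "\<And>x. \<bar>g x\<bar> \<le> b" "b \<ge> 1"
    using f_meas by (auto simp: g_def[abs_def] b_def)
  have fg: "AE x in M. f x = g x" using B by eventually_elim (auto simp: g_def b_def)
  define X where "X T = meas_conv a (\<nu> T) g" for T
  have conv_fg: "AE x in M. meas_conv a (\<nu> T) f x = X T x" for T
    unfolding X_def by (rule AE_meas_conv_cong[OF nu_borel nu_fin fg f_meas g(1)])
  have f_conv_meas: "meas_conv a (\<nu> T) f \<in> borel_measurable M" for T
    by (rule measurable_meas_conv[OF nu_borel nu_fin f_meas])
  have X_meas [measurable]: "X T \<in> borel_measurable M" for T
    unfolding X_def by (rule measurable_meas_conv[OF nu_borel nu_fin g(1)])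
  have X_int: "integrable M (\<lambda>x. X T x ^ k)" for T k
    unfolding X_def by (rule integrable_meas_conv_power[OF nu_borel nu_fin g])
  \<comment> \<open>Only \<open>card J\<close> matters here; indexing by sets puts the moments in
    the form that \<open>cumulant\<close> expects.\<close>
  define m where "m T J = (\<integral>x. X T x ^ card J \<partial>M)" for T and J :: "nat set"
  \<comment> \<open>The mean of \<open>f\<close> is 0, so the first moments vanish and the second
    cumulant is the second moment, which tends to \<open>\<sigma>f\<^sup>2\<close>.\<close>
  have m1: "m T {i} = 0" for T i
  proof -
    have "m T {i} = (\<integral>h. correlation g h {i} \<partial>Pi\<^sub>M {i} (\<lambda>_. \<nu> T))"
      unfolding m_def X_def by (rule integral_correlation[OF nu_borel nu_fin g, symmetric]) simp
    moreover have "correlation g h {i} = 0" for h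
      using correlation_cong_AE[OF fg f_meas g(1), of "{i}" h] integral_fun_act[OF f_meas] f_mean
      by (simp add: correlation_def)
    ultimately show ?thesis by simp
  qed
  have sq: "(\<lambda>T. \<integral>x. (X T x)\<^sup>2 \<partial>M) \<longlonglongrightarrow> \<sigma>f\<^sup>2"
  proof -
    have "(sqrt (\<integral>x. (meas_conv a (\<nu> T) f x)\<^sup>2 \<partial>M))\<^sup>2 = (\<integral>x. (X T x)\<^sup>2 \<partial>M)" for T
    proof -
      have "(\<integral>x. (meas_conv a (\<nu> T) f x)\<^sup>2 \<partial>M) = (\<integral>x. (X T x)\<^sup>2 \<partial>M)"
        using conv_fg[of T] f_conv_meas by (intro integral_cong_AE) auto
      then show ?thesis by simp
    qed
    then show ?thesis using tendsto_power[OF lim, of 2] by simp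
  qed
  have mom: "(\<lambda>T. m T S) \<longlonglongrightarrow> scaled_normal_moment \<sigma>f (card S)" if "finite S" for S
  proof (rule cumulants_imp_gaussian_moments[where v = "\<sigma>f\<^sup>2"])
    show "m T {} = 1" for T by (simp add: m_def prob_space)
    show "(\<lambda>T. cumulant (m T) S) \<longlonglongrightarrow> 0" if "card S = 1" for S
      using that by (auto simp: card_1_singleton_iff cumulant_singleton m1)
    show "(\<lambda>T. cumulant (m T) S) \<longlonglongrightarrow> \<sigma>f\<^sup>2" if "card S = 2" for S
      using that sq by (auto simp: card_2_iff cumulant_doubleton m1) (simp add: m_def numeral_2_eq_2)
    show "(\<lambda>T. cumulant (m T) S) \<longlonglongrightarrow> 0" if "finite S" "card S \<ge> 3" for S
      unfolding m_def X_def
      by (rule cumulant_meas_conv_tendsto_0[OF nu_borel nu_fin nu_mass nu_conc fA fg g that])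
    show "scaled_normal_moment \<sigma>f 0 = 1"
      using scaled_normal_moment_even[of \<sigma>f 0] by simp
    show "scaled_normal_moment \<sigma>f 1 = 0"
      by (rule scaled_normal_moment_odd) simp
    show "scaled_normal_moment \<sigma>f (k + 2) = (real k + 1) * \<sigma>f\<^sup>2 * scaled_normal_moment \<sigma>f k" for k
      by (rule scaled_normal_moment_Suc_Suc)
  qed fact
  have "weak_conv_m (\<lambda>T. distr M borel (X T)) (centered_gaussian \<sigma>f)"
  proof (rule gaussian_moments_imp_weak_conv[OF P X_meas X_int])
    \<comment> \<open>The set \<open>{..<k}\<close> serves as an index set of cardinality
      \<open>k\<close>.\<close>
    show "(\<lambda>T. \<integral>x. X T x ^ k \<partial>M) \<longlonglongrightarrow> scaled_normal_moment \<sigma>f k" for k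
      using mom[of "{..<k}"] by (simp add: m_def)
  qed
  moreover have "distr M borel (meas_conv a (\<nu> T) f) = distr M borel (X T)" for T
    using conv_fg f_conv_meas by (intro distr_cong_AE) auto
  ultimately show ?thesis by simp
qed

end
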